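(* Let $d\ge4$ and let $L\in\mathcal{L}(d)$. The intersection $FX(d) \cap X(L)$ is empty if $$\tau(L) < \frac{3}{4}(d-1)^2.$$ In particular, this inequality holds if $$\sum_p(m_p-1)>\frac{(d+3)(d-1)}{4},$$ where $p$ runs through the set of multiple points of the lattice $L$, and $m_p \geq 2$ denotes the multiplicity of $p$.
   Context: $S=\mathbb{C}[x,y,z]$, $S_m$ its degree $m$ part. $X(d)\subset\mathbb{P}(S_1)^d$ is the set of $d$-tuples $(\ell_1,\dots,\ell_d)$ of pairwise distinct classes of linear forms, each regarded as an (ordered) arrangement $\mathcal{A}:f=\ell_1\cdots\ell_d=0$ of $d$ distinct lines in the complex projective plane. $\mathcal{L}(d)$ is the set of isomorphism classes of intersection lattices of arrangements of $d$ distinct lines; for $L\in\mathcal{L}(d)$, $X(L)\subset X(d)$ is the set of tuples whose arrangement has intersection lattice isomorphic to $L$. $\tau(L)=\sum_p(m_p-1)^2$, the sum over the multiple points $p$ of $L$, of multiplicity $m_p\ge2$. $FX(d)\subset X(d)$ is the set of tuples whose arrangement $f=0$ is free, i.e. such that the graded $S$-module $AR(f)=\{(a,b,c)\in S^3: af_x+bf_y+cf_z=0\}$ is isomorphic to $S(-d_1)\oplus S(-d_2)$ for some integers $0\le d_1\le d_2$. *)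

theory Defs
  imports "HOL-Analysis.Analysis" "HOL-Library.Poly_Mapping"
begin

section \<open>The graded polynomial ring in three variables\<close>

text \<open>
  The ring \<open>S\<close> is the monoid algebra of \<open>\<nat>\<^sup>3\<close> over \<open>\<complex>\<close>: a key \<open>m\<close> is the exponent vector of a
  monomial. The variables \<open>x, y, z\<close> have the indices \<open>1, 2, 3\<close> of the three-element type
  \<open>3\<close> (in which \<open>3 = 0\<close>).
\<close>

type_synonym monomial = "3 \<Rightarrow>\<^sub>0 nat"
type_synonym poly3 = "monomial \<Rightarrow>\<^sub>0 complex"

definition mdeg :: "monomial \<Rightarrow> nat" where
  "mdeg m = (\<Sum>i\<in>UNIV. Poly_Mapping.lookup m i)"

definition S_deg :: "nat \<Rightarrow> poly3 set" where
  "S_deg k = {p. \<forall>m\<in>Poly_Mapping.keys p. mdeg m = k}"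

definition const :: "complex \<Rightarrow> poly3" where
  "const c = Poly_Mapping.single 0 c"

definition eval3 :: "poly3 \<Rightarrow> complex ^ 3 \<Rightarrow> complex" where
  "eval3 p v =
     (\<Sum>m\<in>Poly_Mapping.keys p.
        Poly_Mapping.lookup p m * (\<Prod>i\<in>UNIV. (v $ i) ^ Poly_Mapping.lookup m i))"

text \<open>
  Subtraction of exponent vectors is truncated, which is harmless: monomials that do not
  contain the \<open>i\<close>-th variable get coefficient \<open>0\<close>.
\<close>

definition pdiff :: "3 \<Rightarrow> poly3 \<Rightarrow> poly3" where
  "pdiff i p =
     (\<Sum>m\<in>Poly_Mapping.keys p.
        Poly_Mapping.single (m - Poly_Mapping.single i 1)
          (of_nat (Poly_Mapping.lookup m i) * Poly_Mapping.lookup p m))"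


section \<open>Ordered line arrangements\<close>

definition proj_class :: "poly3 \<Rightarrow> poly3 set" where
  "proj_class l = {const c * l |c. c \<noteq> 0}"

definition PS1 :: "poly3 set set" where
  "PS1 = proj_class ` (S_deg 1 - {0})"

definition X :: "nat \<Rightarrow> poly3 set list set" where
  "X d = {A. length A = d \<and> set A \<subseteq> PS1 \<and> distinct A}"

text \<open>
  Subspaces of the projective plane are represented by their affine cones in \<open>\<complex>\<^sup>3\<close>; so a line
  is a plane through the origin, a point is a line through the origin, and the empty set is
  \<open>{0}\<close>.
\<close>

definition line :: "poly3 set \<Rightarrow> (complex ^ 3) set" where
  "line K = {v. \<forall>l\<in>K. eval3 l v = 0}"


section \<open>Intersection lattices\<close>

text \<open>
  All intersections of lines of the arrangement, including the empty intersection \<open>UNIV\<close>.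
  The order is reverse inclusion, so a lattice is given by its set of elements alone.
\<close>

definition intersection_lattice :: "poly3 set list \<Rightarrow> (complex ^ 3) set set" where
  "intersection_lattice A = Inter ` Pow (line ` set A)"

definition lattice_isomorphic :: "'a set set \<Rightarrow> 'b set set \<Rightarrow> bool" where
  "lattice_isomorphic P Q \<longleftrightarrow>
     (\<exists>\<phi>. bij_betw \<phi> P Q \<and> (\<forall>U\<in>P. \<forall>V\<in>P. U \<supseteq> V \<longleftrightarrow> \<phi> U \<supseteq> \<phi> V))"

definition lattice_iso_rel :: "nat \<Rightarrow> ((complex ^ 3) set set \<times> (complex ^ 3) set set) set" where
  "lattice_iso_rel d =
     {(P, Q). P \<in> intersection_lattice ` X d \<and> Q \<in> intersection_lattice ` X d \<and>
              lattice_isomorphic P Q}"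

definition lattice_classes :: "nat \<Rightarrow> (complex ^ 3) set set set set" where
  "lattice_classes d = (intersection_lattice ` X d) // lattice_iso_rel d"

definition X_lat :: "nat \<Rightarrow> (complex ^ 3) set set set \<Rightarrow> poly3 set list set" where
  "X_lat d L = {A \<in> X d. intersection_lattice A \<in> L}"

text \<open>
  \<open>covered_by P U V\<close>: \<open>V\<close> is an immediate successor of \<open>U\<close> in \<open>P\<close> for reverse inclusion. The
  atoms are the lines of the arrangement, and the elements covering an atom (rank \<open>2\<close>) are its
  multiple points; the multiplicity of a point is the number of lines through it. The
  definitions use the order of \<open>P\<close> only, so they are invariant under lattice isomorphism.
\<close>

definition covered_by :: "'a set set \<Rightarrow> 'a set \<Rightarrow> 'a set \<Rightarrow> bool" where
  "covered_by P U V \<longleftrightarrow>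
     U \<in> P \<and> V \<in> P \<and> U \<supset> V \<and> \<not> (\<exists>W\<in>P. U \<supset> W \<and> W \<supset> V)"

definition least_elems :: "'a set set \<Rightarrow> 'a set set" where
  "least_elems P = {U \<in> P. \<forall>V\<in>P. U \<supseteq> V}"

definition atoms :: "'a set set \<Rightarrow> 'a set set" where
  "atoms P = {H. \<exists>U\<in>least_elems P. covered_by P U H}"

definition multiple_points :: "'a set set \<Rightarrow> 'a set set" where
  "multiple_points P = {p. \<exists>H\<in>atoms P. covered_by P H p}"

definition multiplicity_at :: "'a set set \<Rightarrow> 'a set \<Rightarrow> nat" where
  "multiplicity_at P p = card {H \<in> atoms P. H \<supseteq> p}"

definition lattice_sum :: "(nat \<Rightarrow> real) \<Rightarrow> 'a set set \<Rightarrow> real" where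
  "lattice_sum g P = (\<Sum>p\<in>multiple_points P. g (multiplicity_at P p))"

text \<open>
  \<open>point_sum g L\<close> is \<open>\<Sum>\<^sub>p g(m\<^sub>p)\<close> for an isomorphism class \<open>L\<close>. By \<open>point_sum_eq\<close> below any
  representative of \<open>L\<close> computes it.
\<close>

definition point_sum :: "(nat \<Rightarrow> real) \<Rightarrow> 'a set set set \<Rightarrow> real" where
  "point_sum g L = the_elem (lattice_sum g ` L)"

definition tau :: "(complex ^ 3) set set set \<Rightarrow> real" where
  "tau L = point_sum (\<lambda>m. (real m - 1)\<^sup>2) L"


section \<open>Free arrangements\<close>

definition AR :: "poly3 \<Rightarrow> (poly3 ^ 3) set" where
  "AR f = {v. v $ 1 * pdiff 1 f + v $ 2 * pdiff 2 f + v $ 3 * pdiff 3 f = 0}"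

text \<open>The component of degree \<open>k\<close> of \<open>S(-e)\<close>, which is \<open>S\<^bsub>k-e\<^esub>\<close>.\<close>

definition S_shift :: "nat \<Rightarrow> nat \<Rightarrow> poly3 set" where
  "S_shift e k = (if e \<le> k then S_deg (k - e) else {0})"

text \<open>
  A graded isomorphism from \<open>S(-d1) \<oplus> S(-d2)\<close> onto \<open>AR(f)\<close>: an \<open>S\<close>-linear bijection that maps
  homogeneous elements to homogeneous elements of the same degree.
\<close>

definition AR_graded_iso :: "nat \<Rightarrow> nat \<Rightarrow> poly3 \<Rightarrow> (poly3 ^ 2 \<Rightarrow> poly3 ^ 3) \<Rightarrow> bool" where
  "AR_graded_iso d1 d2 f \<phi> \<longleftrightarrow>
     module_hom (*s) (*s) \<phi> \<and> bij_betw \<phi> UNIV (AR f) \<and>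
     (\<forall>k g. g $ 1 \<in> S_shift d1 k \<longrightarrow> g $ 2 \<in> S_shift d2 k \<longrightarrow> (\<forall>i. \<phi> g $ i \<in> S_deg k))"

definition free_curve :: "poly3 \<Rightarrow> bool" where
  "free_curve f \<longleftrightarrow> (\<exists>d1 d2 \<phi>. d1 \<le> d2 \<and> AR_graded_iso d1 d2 f \<phi>)"

text \<open>
  An equation of the arrangement is a product of representatives of its lines. It is unique up
  to a nonzero constant, which does not change \<open>AR(f)\<close>.
\<close>

definition FX :: "nat \<Rightarrow> poly3 set list set" where
  "FX d = {A \<in> X d. \<exists>ls. list_all2 (\<in>) ls A \<and> free_curve (prod_list ls)}"


section \<open>Well-definedness of sums over the multiple points of a class\<close>

lemma lattice_isomorphic_refl: "lattice_isomorphic P P"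
  unfolding lattice_isomorphic_def by (rule exI[of _ id]) auto

lemma lattice_isomorphic_sym:
  assumes "lattice_isomorphic P Q"
  shows "lattice_isomorphic Q P"
proof -
  obtain \<phi> where \<phi>: "bij_betw \<phi> P Q" "\<forall>U\<in>P. \<forall>V\<in>P. U \<supseteq> V \<longleftrightarrow> \<phi> U \<supseteq> \<phi> V"
    using assms unfolding lattice_isomorphic_def by blast
  let ?\<psi> = "inv_into P \<phi>"
  have inv: "?\<psi> U \<in> P" "\<phi> (?\<psi> U) = U" if "U \<in> Q" for U
    using that \<phi>(1) by (simp_all add: bij_betw_def inv_into_into f_inv_into_f)
  have "U \<supseteq> V \<longleftrightarrow> ?\<psi> U \<supseteq> ?\<psi> V" if "U \<in> Q" "V \<in> Q" for U V
    using \<phi>(2)[rule_format, OF inv(1)[OF that(1)] inv(1)[OF that(2)]]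
    unfolding inv(2)[OF that(1)] inv(2)[OF that(2)] by (rule sym)
  then show ?thesis
    unfolding lattice_isomorphic_def using bij_betw_inv_into[OF \<phi>(1)] by blast
qed

lemma lattice_isomorphic_trans:
  assumes "lattice_isomorphic P Q" "lattice_isomorphic Q R"
  shows "lattice_isomorphic P R"
proof -
  obtain \<phi> where \<phi>: "bij_betw \<phi> P Q" "\<forall>U\<in>P. \<forall>V\<in>P. U \<supseteq> V \<longleftrightarrow> \<phi> U \<supseteq> \<phi> V"
    using assms(1) unfolding lattice_isomorphic_def by blast
  obtain \<psi> where \<psi>: "bij_betw \<psi> Q R" "\<forall>U\<in>Q. \<forall>V\<in>Q. U \<supseteq> V \<longleftrightarrow> \<psi> U \<supseteq> \<psi> V"
    using assms(2) unfolding lattice_isomorphic_def by blast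
  have im: "\<phi> U \<in> Q" if "U \<in> P" for U
    using that bij_betwE[OF \<phi>(1)] by simp
  have ord: "U \<supseteq> V \<longleftrightarrow> (\<psi> \<circ> \<phi>) U \<supseteq> (\<psi> \<circ> \<phi>) V" if "U \<in> P" "V \<in> P" for U V
    using \<phi>(2)[rule_format, OF that] \<psi>(2)[rule_format, OF im[OF that(1)] im[OF that(2)]]
    by (simp only: o_apply)
  show ?thesis
    unfolding lattice_isomorphic_def
    by (intro exI[of _ "\<psi> \<circ> \<phi>"] conjI ballI bij_betw_trans[OF \<phi>(1) \<psi>(1)] ord)
qed

lemma equiv_lattice_iso_rel: "equiv (intersection_lattice ` X d) (lattice_iso_rel d)"
proof (rule equivI)
  show "lattice_iso_rel d \<subseteq> intersection_lattice ` X d \<times> intersection_lattice ` X d"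
    unfolding lattice_iso_rel_def by blast
  show "refl_on (intersection_lattice ` X d) (lattice_iso_rel d)"
    unfolding lattice_iso_rel_def by (rule refl_onI) (simp add: lattice_isomorphic_refl)
  show "sym (lattice_iso_rel d)"
    unfolding lattice_iso_rel_def by (rule symI) (simp add: lattice_isomorphic_sym)
  show "trans (lattice_iso_rel d)"
  proof (rule transI)
    fix P Q R
    assume "(P, Q) \<in> lattice_iso_rel d" "(Q, R) \<in> lattice_iso_rel d"
    then show "(P, R) \<in> lattice_iso_rel d"
      unfolding lattice_iso_rel_def using lattice_isomorphic_trans[of P Q R] by simp
  qed
qed

lemma lattice_sum_cong:
  assumes "lattice_isomorphic P Q"
  shows "lattice_sum g P = lattice_sum g Q"
proof -
  obtain \<phi> where bij: "bij_betw \<phi> P Q"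
    and ord': "\<forall>U\<in>P. \<forall>V\<in>P. U \<supseteq> V \<longleftrightarrow> \<phi> U \<supseteq> \<phi> V"
    using assms unfolding lattice_isomorphic_def by blast
  have ord: "\<phi> U \<supseteq> \<phi> V \<longleftrightarrow> U \<supseteq> V" if "U \<in> P" "V \<in> P" for U V
    using ord'[rule_format, OF that] by (rule sym)
  have Q: "Q = \<phi> ` P" and inj: "inj_on \<phi> P"
    using bij by (auto simp: bij_betw_def)
  have sord: "\<phi> U \<supset> \<phi> V \<longleftrightarrow> U \<supset> V" if "U \<in> P" "V \<in> P" for U V
    unfolding less_le_not_le ord[OF that] ord[OF that(2,1)] ..
  have cov: "covered_by Q (\<phi> U) (\<phi> V) \<longleftrightarrow> covered_by P U V" if "U \<in> P" "V \<in> P" for U V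
    using that unfolding covered_by_def Q by (simp add: sord cong: conj_cong)
  have covP: "U \<in> P \<and> V \<in> P" if "covered_by P U V" for U V
    using that by (simp add: covered_by_def)
  have covQ: "U \<in> Q \<and> V \<in> Q" if "covered_by Q U V" for U V
    using that by (simp add: covered_by_def)
  have least: "least_elems Q = \<phi> ` least_elems P"
  proof (intro set_eqI iffI)
    fix W assume "W \<in> least_elems Q"
    then have W: "W \<in> \<phi> ` P" "\<And>V. V \<in> P \<Longrightarrow> \<phi> V \<subseteq> W"
      by (simp_all add: least_elems_def Q)
    obtain U where U: "U \<in> P" "W = \<phi> U"
      using W(1) by (rule imageE)
    have "V \<subseteq> U" if "V \<in> P" for V
      using W(2)[OF that] ord[OF U(1) that] U(2) by simp
    then have "U \<in> least_elems P"
      using U(1) by (simp add: least_elems_def)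
    then show "W \<in> \<phi> ` least_elems P"
      using U(2) by simp
  next
    fix W assume "W \<in> \<phi> ` least_elems P"
    then obtain U where U: "U \<in> least_elems P" "W = \<phi> U"
      by (rule imageE)
    then have "U \<in> P" "\<And>V. V \<in> P \<Longrightarrow> \<phi> V \<subseteq> \<phi> U"
      using ord by (simp_all add: least_elems_def)
    then show "W \<in> least_elems Q"
      using U(2) by (simp add: least_elems_def Q)
  qed
  have succ: "{V. \<exists>U\<in>\<phi> ` A. covered_by Q U V} = \<phi> ` {V. \<exists>U\<in>A. covered_by P U V}"
    if A: "A \<subseteq> P" for A
  proof (intro set_eqI iffI)
    fix W assume "W \<in> {V. \<exists>U\<in>\<phi> ` A. covered_by Q U V}"
    then obtain U where U: "U \<in> A" "covered_by Q (\<phi> U) W"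
      by auto
    then have "W \<in> \<phi> ` P"
      using covQ[OF U(2)] Q by simp
    then obtain V where V: "V \<in> P" "W = \<phi> V"
      by (rule imageE)
    have "covered_by P U V"
      using U V A cov[of U V] by (simp add: subsetD)
    then show "W \<in> \<phi> ` {V. \<exists>U\<in>A. covered_by P U V}"
      using U(1) V(2) by (intro image_eqI[of _ _ V]) auto
  next
    fix W assume "W \<in> \<phi> ` {V. \<exists>U\<in>A. covered_by P U V}"
    then obtain U V where UV: "U \<in> A" "covered_by P U V" "W = \<phi> V"
      by auto
    then have "covered_by Q (\<phi> U) W"
      using cov[of U V] covP[OF UV(2)] by simp
    then show "W \<in> {V. \<exists>U\<in>\<phi> ` A. covered_by Q U V}"
      using UV(1) by (intro CollectI bexI[of _ "\<phi> U"]) auto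
  qed
  have lP: "least_elems P \<subseteq> P"
    by (simp add: least_elems_def)
  have aP: "atoms P \<subseteq> P"
  proof
    fix H assume "H \<in> atoms P"
    then obtain U where "covered_by P U H"
      unfolding atoms_def by (elim CollectE bexE)
    then show "H \<in> P"
      using covP by simp
  qed
  have mpP: "multiple_points P \<subseteq> P"
  proof
    fix p assume "p \<in> multiple_points P"
    then obtain H where "covered_by P H p"
      unfolding multiple_points_def by (elim CollectE bexE)
    then show "p \<in> P"
      using covP by simp
  qed
  have at: "atoms Q = \<phi> ` atoms P"
    unfolding atoms_def least by (rule succ[OF lP])
  have mp: "multiple_points Q = \<phi> ` multiple_points P"
    unfolding multiple_points_def at by (rule succ[OF aP])
  have mult: "multiplicity_at Q (\<phi> p) = multiplicity_at P p" if p: "p \<in> P" for p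
  proof -
    have "{H \<in> atoms Q. H \<supseteq> \<phi> p} = \<phi> ` {H \<in> atoms P. \<phi> H \<supseteq> \<phi> p}"
      unfolding at by (auto simp only: image_iff mem_Collect_eq set_eq_iff)
    also have "{H \<in> atoms P. \<phi> H \<supseteq> \<phi> p} = {H \<in> atoms P. H \<supseteq> p}"
      using ord[OF _ p] aP by (intro Collect_cong conj_cong refl) (simp add: subsetD)
    finally have "{H \<in> atoms Q. H \<supseteq> \<phi> p} = \<phi> ` {H \<in> atoms P. H \<supseteq> p}" .
    moreover have "inj_on \<phi> {H \<in> atoms P. H \<supseteq> p}"
      by (rule inj_on_subset[OF inj], rule subset_trans[OF _ aP]) simp
    ultimately show ?thesis
      unfolding multiplicity_at_def by (simp add: card_image)
  qed
  show ?thesis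
    unfolding lattice_sum_def mp sum.reindex[OF inj_on_subset[OF inj mpP]]
    by (rule sum.cong[OF refl]) (simp add: mult subsetD[OF mpP])
qed

lemma point_sum_eq:
  assumes "L \<in> lattice_classes d" "P \<in> L"
  shows "point_sum g L = lattice_sum g P"
proof -
  have "lattice_isomorphic P Q" if "Q \<in> L" for Q
  proof -
    have "(P, Q) \<in> lattice_iso_rel d"
      using in_quotient_imp_in_rel[OF equiv_lattice_iso_rel, of L d P Q] assms that
      unfolding lattice_classes_def by simp
    then show ?thesis
      unfolding lattice_iso_rel_def by simp
  qed
  then have "lattice_sum g Q = lattice_sum g P" if "Q \<in> L" for Q
    using lattice_sum_cong that by metis
  then have "lattice_sum g ` L = (\<lambda>_. lattice_sum g P) ` L"
    by (rule image_cong[OF refl])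
  also have "\<dots> = {lattice_sum g P}"
    using assms(2) by (intro image_constant)
  finally show ?thesis
    by (simp add: point_sum_def)
qed

end

theory Submission
  imports Defs
begin

text \<open>
  Let \<open>f = \<alpha>\<^sub>0 \<cdots> \<alpha>\<^bsub>d-1\<^esub>\<close> be an equation of the arrangement, put \<open>s\<^sub>k = dim S\<^sub>k = (k+1)(k+2)/2\<close>, and let
  \<open>D\<^sub>k(n)\<close> be the space of polynomial vector fields of degree \<open>k\<close> that are tangent to the first
  \<open>n\<close> lines, i.e. that map \<open>\<alpha>\<^sub>j\<close> into the ideal \<open>(\<alpha>\<^sub>j)\<close> for all \<open>j < n\<close>. The dimension of \<open>D\<^sub>k(d)\<close> is
  computed in two ways for large \<open>k\<close>.

  If \<open>f\<close> is free with exponents \<open>d\<^sub>1, d\<^sub>2\<close>, then \<open>dim AR(f)\<^sub>k = s\<^bsub>k-d\<^sub>1\<^esub> + s\<^bsub>k-d\<^sub>2\<^esub>\<close>. A field that kills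
  \<open>f\<close> is tangent to every line, and the tangent fields split into \<open>AR(f)\<close> and the multiples of the
  Euler field, so \<open>dim D\<^sub>k(d) = s\<^bsub>k-d\<^sub>1\<^esub> + s\<^bsub>k-d\<^sub>2\<^esub> + s\<^bsub>k-1\<^esub>\<close> (\<open>dim_tangent_eq_AR\<close>).

  On the other hand, add the lines one at a time. Passing from \<open>D\<^sub>k(n)\<close> to \<open>D\<^sub>k(n+1)\<close> imposes the
  condition \<open>\<theta>(\<alpha>\<^sub>n) \<in> (\<alpha>\<^sub>n)\<close>, which amounts to at most \<open>s\<^sub>k - s\<^bsub>k-1\<^esub> = k + 1\<close> linear conditions. Not many
  of these are redundant: with \<open>f\<^sub>n = \<alpha>\<^sub>0 \<cdots> \<alpha>\<^bsub>n-1\<^esub>\<close> and a constant field \<open>v\<close> that kills \<open>\<alpha>\<^sub>i\<close> but not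
  \<open>\<alpha>\<^sub>n\<close>, the multiples of \<open>(f\<^sub>n/\<alpha>\<^sub>i) v\<close> are tangent to the first \<open>n\<close> lines, so the values \<open>\<theta>(\<alpha>\<^sub>n)\<close>
  fill, modulo \<open>\<alpha>\<^sub>n\<close>, the ideal generated by all the \<open>f\<^sub>n/\<alpha>\<^sub>i\<close>. In high degrees its codimension is at most \<open>n - r\<^sub>n\<close>
  (\<open>codim_restriction_ideal\<close>), where \<open>r\<^sub>n\<close> is the number of points in which line \<open>n\<close> meets the
  earlier lines. A point of multiplicity \<open>m\<^sub>p\<close> is counted by all of its lines but the first, so
  \<open>\<Sum>\<^sub>n r\<^sub>n = \<Sum>\<^sub>p (m\<^sub>p - 1)\<close>, and altogether
  \<open>3 s\<^sub>k - d(k+1) \<le> dim D\<^sub>k(d) \<le> 3 s\<^sub>k - d(k+1) + d(d-1)/2 - \<Sum>\<^sub>p (m\<^sub>p - 1)\<close>.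

  Both computations are quadratic polynomials in \<open>k\<close>. Comparing the linear terms gives
  \<open>d\<^sub>1 + d\<^sub>2 = d - 1\<close>, and then the constant terms give \<open>\<Sum>\<^sub>p (m\<^sub>p - 1) \<le> d\<^sub>1 d\<^sub>2 + d\<^sub>1 + d\<^sub>2\<close>
  (\<open>free_exponents\<close>). Counting ordered pairs of lines by their intersection point gives
  \<open>\<Sum>\<^sub>p m\<^sub>p (m\<^sub>p - 1) = d(d-1)\<close>, hence \<open>\<tau> = d(d-1) - \<Sum>\<^sub>p (m\<^sub>p - 1)\<close>. Therefore a free arrangement has
  \<open>\<tau> \<ge> (d-1)\<^sup>2 - d\<^sub>1 d\<^sub>2 \<ge> 3/4 (d-1)\<^sup>2\<close>, which is the first claim, and the second claim is the
  formula for \<open>\<tau>\<close> itself.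
\<close>


section \<open>Homogeneous polynomials and partial derivatives\<close>

lemma mdeg_add: "mdeg (m + n) = mdeg m + mdeg n"
  by (simp add: mdeg_def lookup_add sum.distrib)

lemma mdeg_single: "mdeg (Poly_Mapping.single i c) = c"
  by (simp add: mdeg_def lookup_single when_def)

lemma in_S_deg_iff: "p \<in> S_deg k \<longleftrightarrow> (\<forall>m. mdeg m \<noteq> k \<longrightarrow> Poly_Mapping.lookup p m = 0)"
  by (auto simp: S_deg_def in_keys_iff)

lemma S_deg_zero [simp]: "0 \<in> S_deg k"
  by (simp add: in_S_deg_iff)

lemma S_deg_add: "p \<in> S_deg k \<Longrightarrow> q \<in> S_deg k \<Longrightarrow> p + q \<in> S_deg k"
  by (simp add: in_S_deg_iff lookup_add)

lemma S_deg_uminus: "p \<in> S_deg k \<Longrightarrow> - p \<in> S_deg k"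
  by (simp add: in_S_deg_iff)

lemma S_deg_diff: "p \<in> S_deg k \<Longrightarrow> q \<in> S_deg k \<Longrightarrow> p - q \<in> S_deg k"
  by (simp add: in_S_deg_iff lookup_minus)

lemma S_deg_sum: "(\<And>i. i \<in> I \<Longrightarrow> p i \<in> S_deg k) \<Longrightarrow> sum p I \<in> S_deg k"
  by (induction I rule: infinite_finite_induct) (auto intro: S_deg_add)

lemma S_deg_single: "mdeg m = k \<Longrightarrow> Poly_Mapping.single m c \<in> S_deg k"
  by (auto simp: in_S_deg_iff lookup_single when_def)

lemma poly3_eq_sum_singles:
  "(p :: poly3) = (\<Sum>m\<in>Poly_Mapping.keys p. Poly_Mapping.single m (Poly_Mapping.lookup p m))"
  by (rule poly_mapping_eqI) (auto simp: lookup_sum lookup_single when_def in_keys_iff)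

text \<open>
  The predicate need not be stable under scalars, because a monomial comes with its coefficient.
\<close>

lemma S_deg_induct [consumes 1, case_names zero add single]:
  assumes "p \<in> S_deg k" and "P 0"
    and "\<And>p q. P p \<Longrightarrow> P q \<Longrightarrow> P (p + q)"
    and "\<And>m c. mdeg m = k \<Longrightarrow> P (Poly_Mapping.single m c)"
  shows "P p"
proof -
  have "P (\<Sum>m\<in>A. Poly_Mapping.single m (Poly_Mapping.lookup p m))"
    if "finite A" "A \<subseteq> Poly_Mapping.keys p" for A
    using that assms(1) by (induction A rule: finite_induct) (auto intro!: assms(2-4) simp: S_deg_def)
  from this[OF finite_keys subset_refl] show ?thesis
    by (simp flip: poly3_eq_sum_singles)
qed

lemma poly3_induct [case_names add single]:
  assumes "\<And>p q. P p \<Longrightarrow> P q \<Longrightarrow> P (p + q)" and "\<And>m c. P (Poly_Mapping.single m c)"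
  shows "P (p :: poly3)"
proof -
  have 0: "P 0" using assms(2)[of 0 0] by simp
  have "P (\<Sum>m\<in>A. Poly_Mapping.single m (Poly_Mapping.lookup p m))" if "finite A" for A
    using that by (induction A rule: finite_induct) (auto intro: assms 0)
  from this[OF finite_keys, of p] show ?thesis
    by (simp flip: poly3_eq_sum_singles)
qed

lemma S_deg_mult: "p \<in> S_deg k \<Longrightarrow> q \<in> S_deg l \<Longrightarrow> p * q \<in> S_deg (k + l)"
proof (induction p rule: S_deg_induct)
  case (single m c)
  from single(2,1) show ?case
    by (induction q rule: S_deg_induct)
      (auto simp: mult_single ring_distribs mdeg_add intro: S_deg_add S_deg_single)
qed (auto simp: ring_distribs intro: S_deg_add)

lemma S_deg_one: "1 \<in> S_deg 0"
  unfolding single_one[symmetric] by (rule S_deg_single) (simp add: mdeg_def)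

lemma S_deg_prod:
  assumes "\<And>i. i \<in> I \<Longrightarrow> p i \<in> S_deg 1"
  shows "prod p I \<in> S_deg (card I)"
  using assms
proof (induction I rule: infinite_finite_induct)
  case (insert i I)
  then show ?case using S_deg_mult[of "p i" 1 "prod p I" "card I"] by simp
qed (simp_all add: S_deg_one)

lemma const_in_S_deg: "const c \<in> S_deg 0"
  unfolding const_def by (rule S_deg_single) (simp add: mdeg_def)

lemma const_mult_in_S_deg: "p \<in> S_deg k \<Longrightarrow> const c * p \<in> S_deg k"
  using S_deg_mult[OF const_in_S_deg] by simp

lemma const_add: "const (a + b) = const a + const b"
  by (simp add: const_def single_add)

lemma const_mult: "const (a * b) = const a * const b"
  by (simp add: const_def mult_single)

lemma const_0 [simp]: "const 0 = 0"
  by (simp add: const_def)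

lemma const_1 [simp]: "const 1 = 1"
  by (simp add: const_def)

lemma const_of_nat: "const (of_nat n) = of_nat n"
  by (induction n) (simp_all add: const_add)

lemma const_eq_0_iff [simp]: "const c = 0 \<longleftrightarrow> c = 0"
  unfolding const_def by (metis lookup_single_eq lookup_zero single_zero)

lemma S_deg_0E:
  assumes "p \<in> S_deg 0" obtains c where "p = const c"
proof -
  have "m = 0" if "mdeg m = 0" for m
    using that by (intro poly_mapping_eqI) (simp add: mdeg_def)
  then have "p = const (Poly_Mapping.lookup p 0)"
    using assms unfolding in_S_deg_iff
    by (intro poly_mapping_eqI) (auto simp: const_def lookup_single when_def)
  then show ?thesis by (rule that)
qed

definition homog_component :: "nat \<Rightarrow> poly3 \<Rightarrow> poly3" where
  "homog_component k p = Poly_Mapping.mapp (\<lambda>m c. c when mdeg m = k) p"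

lemma lookup_homog_component: "Poly_Mapping.lookup (homog_component k p) m = (Poly_Mapping.lookup p m when mdeg m = k)"
  by (auto simp: homog_component_def lookup_mapp when_def in_keys_iff)

lemma homog_component_add: "homog_component k (p + q) = homog_component k p + homog_component k q"
  by (rule poly_mapping_eqI) (auto simp: lookup_homog_component lookup_add when_def)

lemma homog_component_in_S_deg: "homog_component k p \<in> S_deg k"
  by (simp add: in_S_deg_iff lookup_homog_component)

lemma homog_component_S_deg: "p \<in> S_deg l \<Longrightarrow> homog_component k p = (if k = l then p else 0)"
  by (rule poly_mapping_eqI) (auto simp: lookup_homog_component in_S_deg_iff when_def)

text \<open>
  The sum that defines the derivative has truncated exponents, so monomials without the variable
  \<open>i\<close> also land somewhere; their coefficient is \<open>0\<close>. Reading off coefficients removes the truncation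
  once and for all.
\<close>

lemma lookup_pdiff:
  "Poly_Mapping.lookup (pdiff i p) m =
     of_nat (Poly_Mapping.lookup m i + 1) * Poly_Mapping.lookup p (m + Poly_Mapping.single i 1)"
proof -
  let ?e = "Poly_Mapping.single i (1::nat)"
  have *: "(of_nat (Poly_Mapping.lookup n i) * Poly_Mapping.lookup p n when n - ?e = m) =
      (if n = m + ?e then of_nat (Poly_Mapping.lookup m i + 1) * Poly_Mapping.lookup p n else 0)" for n
  proof (cases "n = m + ?e")
    case True
    then show ?thesis by (simp add: lookup_add)
  next
    case False
    have "Poly_Mapping.lookup n i = 0" if "n - ?e = m"
    proof (rule ccontr)
      assume "Poly_Mapping.lookup n i \<noteq> 0"
      then have "n = (n - ?e) + ?e"
        by (intro poly_mapping_eqI) (auto simp: lookup_add lookup_minus lookup_single when_def)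
      then show False using that False by simp
    qed
    then show ?thesis using False by (auto simp: when_def)
  qed
  have "Poly_Mapping.lookup (pdiff i p) m = (\<Sum>n\<in>Poly_Mapping.keys p.
      of_nat (Poly_Mapping.lookup n i) * Poly_Mapping.lookup p n when n - ?e = m)"
    by (simp add: pdiff_def lookup_sum lookup_single)
  also have "\<dots> = of_nat (Poly_Mapping.lookup m i + 1) * Poly_Mapping.lookup p (m + ?e)"
    unfolding * by (auto simp: in_keys_iff)
  finally show ?thesis .
qed

lemma pdiff_add: "pdiff i (p + q) = pdiff i p + pdiff i q"
  by (rule poly_mapping_eqI) (simp add: lookup_pdiff lookup_add algebra_simps)

lemma pdiff_0 [simp]: "pdiff i 0 = 0"
  by (simp add: pdiff_def)

lemma pdiff_single:
  "pdiff i (Poly_Mapping.single m c) =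
     Poly_Mapping.single (m - Poly_Mapping.single i 1) (of_nat (Poly_Mapping.lookup m i) * c)"
  by (simp add: pdiff_def)

lemma pdiff_mult: "pdiff i (p * q) = pdiff i p * q + p * pdiff i q"
proof (induction p rule: poly3_induct)
  case (add p p')
  then show ?case by (simp add: pdiff_add ring_distribs algebra_simps)
next
  case (single m c)
  show ?case
  proof (induction q rule: poly3_induct)
    case (add q q')
    then show ?case by (simp add: pdiff_add ring_distribs algebra_simps)
  next
    case (single n b)
    let ?e = "Poly_Mapping.single i (1::nat)"
    have *: "m' - ?e + n' = m' + n' - ?e" if "Poly_Mapping.lookup m' i \<noteq> 0" for m' n' :: monomial
      using that by (intro poly_mapping_eqI) (auto simp: lookup_add lookup_minus lookup_single when_def)
    have 1: "pdiff i (Poly_Mapping.single m c) * Poly_Mapping.single n b =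
        Poly_Mapping.single (m + n - ?e) (of_nat (Poly_Mapping.lookup m i) * (c * b))"
      using *[of m n] by (cases "Poly_Mapping.lookup m i = 0") (simp_all add: pdiff_single mult_single algebra_simps)
    have 2: "Poly_Mapping.single m c * pdiff i (Poly_Mapping.single n b) =
        Poly_Mapping.single (m + n - ?e) (of_nat (Poly_Mapping.lookup n i) * (c * b))"
      using *[of n m] by (cases "Poly_Mapping.lookup n i = 0") (simp_all add: pdiff_single mult_single algebra_simps)
    show ?case
      unfolding 1 2 by (simp add: mult_single pdiff_single lookup_add single_add[symmetric] ring_distribs)
  qed
qed

lemma pdiff_S_deg: "p \<in> S_deg k \<Longrightarrow> pdiff i p \<in> S_deg (k - 1)"
  by (auto simp: in_S_deg_iff lookup_pdiff mdeg_add mdeg_single)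

lemma pdiff_S_deg_0: "p \<in> S_deg 0 \<Longrightarrow> pdiff i p = 0"
  by (rule poly_mapping_eqI) (simp add: in_S_deg_iff lookup_pdiff mdeg_add mdeg_single)

lemma pdiff_const [simp]: "pdiff i (const c) = 0"
  by (rule pdiff_S_deg_0[OF const_in_S_deg])

definition var :: "3 \<Rightarrow> poly3" where
  "var i = Poly_Mapping.single (Poly_Mapping.single i 1) 1"

lemma var_in_S_deg: "var i \<in> S_deg 1"
  unfolding var_def by (rule S_deg_single) (rule mdeg_single)

lemma single_sum_right: "Poly_Mapping.single m (sum f I) = (\<Sum>i\<in>I. Poly_Mapping.single m (f i))"
  by (induction I rule: infinite_finite_induct) (simp_all add: single_add)

text \<open>
  Besides its usual role, this identity later writes a homogeneous polynomial of positive degree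
  explicitly as a combination of the variables with coefficients of one degree less.
\<close>

lemma Euler_identity:
  assumes "p \<in> S_deg k"
  shows "(\<Sum>i\<in>UNIV. var i * pdiff i p) = of_nat k * p"
  using assms
proof (induction p rule: S_deg_induct)
  case (single m c)
  have "var i * pdiff i (Poly_Mapping.single m c) = Poly_Mapping.single m (of_nat (Poly_Mapping.lookup m i) * c)" for i
  proof (cases "Poly_Mapping.lookup m i = 0")
    case False
    then have "Poly_Mapping.single i 1 + (m - Poly_Mapping.single i 1) = m"
      by (intro poly_mapping_eqI) (auto simp: lookup_add lookup_minus lookup_single when_def)
    then show ?thesis by (simp add: var_def pdiff_single mult_single)
  qed (simp add: pdiff_single)
  then have "(\<Sum>i\<in>UNIV. var i * pdiff i (Poly_Mapping.single m c)) =
      Poly_Mapping.single m (\<Sum>i\<in>UNIV. of_nat (Poly_Mapping.lookup m i) * c)"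
    by (simp add: single_sum_right)
  also have "\<dots> = const (of_nat k) * Poly_Mapping.single m c"
    using single by (simp only: const_def mult_single add_0 mdeg_def flip: sum_distrib_right of_nat_sum)
  finally show ?case by (simp add: const_of_nat)
qed (simp_all add: pdiff_add ring_distribs sum.distrib)

section \<open>Dimensions of finitely spanned subspaces\<close>

text \<open>
  The ambient spaces here have infinite dimension, so the dimension formulas are stated for
  subspaces that lie in the span of a finite set. Without this restriction \<open>dim\<close> is not monotone.
\<close>

context vector_space begin

definition fin_spanned :: "'b set \<Rightarrow> bool" where
  "fin_spanned V \<longleftrightarrow> (\<exists>B. finite B \<and> V \<subseteq> span B)"

lemma fin_spanned_subset: "local.fin_spanned V \<Longrightarrow> U \<subseteq> V \<Longrightarrow> local.fin_spanned U"
  unfolding local.fin_spanned_def by blast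

lemma fin_spanned_independent: "local.fin_spanned V \<Longrightarrow> \<not> dependent B \<Longrightarrow> B \<subseteq> V \<Longrightarrow> finite B"
  unfolding local.fin_spanned_def using independent_span_bound by blast

lemma fin_spanned_basis:
  assumes "local.fin_spanned V"
  obtains B where "finite B" "B \<subseteq> V" "\<not> dependent B" "V \<subseteq> span B" "card B = dim V"
proof -
  obtain B where "B \<subseteq> V" "\<not> dependent B" "V \<subseteq> span B" "card B = dim V"
    by (rule basis_exists)
  then show ?thesis using that local.fin_spanned_independent[OF assms] by blast
qed

lemma dim_mono_fin_spanned:
  assumes "local.fin_spanned V" "U \<subseteq> V"
  shows "dim U \<le> dim V"
proof -
  obtain B where "finite B" "B \<subseteq> V" "\<not> dependent B" "V \<subseteq> span B" "card B = dim V"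
    by (rule local.fin_spanned_basis[OF assms(1)])
  then show ?thesis
    using dim_le_card[of U B] assms(2) by simp
qed

lemma dim_le_add_card:
  assumes "V \<subseteq> span (W \<union> F)" "local.fin_spanned W" "finite F"
  shows "dim V \<le> dim W + card F"
proof -
  obtain B where B: "finite B" "B \<subseteq> W" "\<not> dependent B" "W \<subseteq> span B" "card B = dim W"
    by (rule local.fin_spanned_basis[OF assms(2)])
  have "W \<union> F \<subseteq> span (B \<union> F)"
    using B(4) span_mono[of B "B \<union> F"] span_superset[of "B \<union> F"] by blast
  then have "V \<subseteq> span (B \<union> F)"
    using assms(1) span_minimal subspace_span by blast
  then have "dim V \<le> card (B \<union> F)"
    using B(1) assms(3) by (intro dim_le_card) auto
  also have "\<dots> \<le> dim W + card F"
    using card_Un_le[of B F] B(5) by simp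
  finally show ?thesis .
qed

end

text \<open>
  A linear map may be prescribed on a basis. This also shows that the two parts of an independent
  set span subspaces with trivial intersection.
\<close>

lemma (in vector_space) exists_projection_along_subbasis:
  assumes "A \<subseteq> B" "\<not> dependent B"
  shows "\<exists>p. Vector_Spaces.linear scale scale p \<and>
    (\<forall>x\<in>span A. p x = 0) \<and> (\<forall>x\<in>span (B - A). p x = x)"
proof -
  interpret q: vector_space_pair scale scale ..
  obtain p where p: "Vector_Spaces.linear scale scale p" "\<And>b. b \<in> B \<Longrightarrow> p b = (if b \<in> A then 0 else b)"
    using q.linear_independent_extend[OF assms(2), of "\<lambda>b. if b \<in> A then 0 else b"] by auto
  have "p x = 0" if "x \<in> span A" for x
    by (rule q.linear_eq_0_on_span[OF p(1) _ that]) (use p(2) assms(1) in auto)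
  moreover have "p x = x" if "x \<in> span (B - A)" for x
    by (rule q.linear_eq_on[OF p(1) linear_ident that]) (use p(2) in auto)
  ultimately show ?thesis using p(1) by blast
qed

context vector_space_pair begin

text \<open>
  A basis of the kernel extends to a basis of \<open>V\<close>, and \<open>f\<close> is injective on the span of the added
  vectors.
\<close>

lemma rank_nullity_on_subspace:
  assumes f: "Vector_Spaces.linear s1 s2 f" and V: "vs1.subspace V" "vs1.fin_spanned V"
  shows "vs1.dim V = vs1.dim {x \<in> V. f x = 0} + vs2.dim (f ` V)"
proof -
  let ?K = "{x \<in> V. f x = 0}"
  interpret f: Vector_Spaces.linear s1 s2 f by (rule f)
  have K: "vs1.subspace ?K"
    using V(1) by (auto simp: vs1.subspace_def f.add f.scale f.zero)
  have "vs1.fin_spanned ?K"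
    by (rule vs1.fin_spanned_subset[OF V(2)]) auto
  then obtain A where A: "finite A" "A \<subseteq> ?K" "\<not> vs1.dependent A" "?K \<subseteq> vs1.span A" "card A = vs1.dim ?K"
    by (rule vs1.fin_spanned_basis)
  have "A \<subseteq> V" using A(2) by auto
  then obtain B where B: "A \<subseteq> B" "B \<subseteq> V" "\<not> vs1.dependent B" "V \<subseteq> vs1.span B"
    using vs1.maximal_independent_subset_extend[OF _ A(3)] by blast
  have finB: "finite B" by (rule vs1.fin_spanned_independent[OF V(2) B(3,2)])
  have spA: "vs1.span A = ?K"
    using A(2,4) vs1.span_minimal[OF A(2) K] by blast
  have spB: "vs1.span B = V"
    using B(2,4) vs1.span_minimal[OF B(2) V(1)] by blast
  obtain q where q: "Vector_Spaces.linear s1 s1 q"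
    "\<And>x. x \<in> vs1.span A \<Longrightarrow> q x = 0" "\<And>x. x \<in> vs1.span (B - A) \<Longrightarrow> q x = x"
    using vs1.exists_projection_along_subbasis[OF B(1,3)] by auto
  have inj: "inj_on f (vs1.span (B - A))"
  proof (rule inj_onI)
    fix x y assume xy: "x \<in> vs1.span (B - A)" "y \<in> vs1.span (B - A)" "f x = f y"
    have z: "x - y \<in> vs1.span (B - A)" using xy by (simp add: vs1.span_diff)
    then have "x - y \<in> V" using spB vs1.span_mono[of "B - A" B] by blast
    then have "x - y \<in> vs1.span A" using xy(3) spA by (simp add: f.diff)
    then have "q (x - y) = 0" by (rule q(2))
    then have "x - y = 0" using q(3)[OF z] by simp
    then show "x = y" by simp
  qed
  have ind: "\<not> vs2.dependent (f ` (B - A))"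
    using linear_independent_injective_image[OF f _ inj] vs1.independent_mono[OF B(3)] by blast
  have "f ` V \<subseteq> vs2.span (f ` (B - A))"
  proof -
    have "f ` V = vs2.span (f ` B)"
      using f.span_image[of B] spB by simp
    also have "\<dots> \<subseteq> vs2.span (f ` (B - A))"
    proof (rule vs2.span_minimal)
      show "f ` B \<subseteq> vs2.span (f ` (B - A))"
      proof safe
        fix b assume "b \<in> B"
        show "f b \<in> vs2.span (f ` (B - A))"
        proof (cases "b \<in> A")
          case True
          then have "f b = 0" using A(2) by auto
          then show ?thesis by (simp add: vs2.span_zero)
        next
          case False
          then show ?thesis using \<open>b \<in> B\<close> by (auto intro: vs2.span_base)
        qed
      qed
    qed auto
    finally show ?thesis .
  qed
  then have "card (f ` (B - A)) = vs2.dim (f ` V)"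
    using ind B(2) by (intro vs2.basis_card_eq_dim) auto
  moreover have "card (f ` (B - A)) = card (B - A)"
    by (rule card_image) (rule inj_on_subset[OF inj vs1.span_superset])
  moreover have "card B = vs1.dim V"
    by (rule vs1.basis_card_eq_dim[OF B(2,4,3)])
  moreover have "card (B - A) = card B - card A" "card A \<le> card B"
    using card_Diff_subset[OF A(1) B(1)] card_mono[OF finB B(1)] by auto
  ultimately show ?thesis using A(5) by simp
qed

lemma fin_spanned_image:
  assumes f: "Vector_Spaces.linear s1 s2 f" and "vs1.fin_spanned V"
  shows "vs2.fin_spanned (f ` V)"
proof -
  interpret f: Vector_Spaces.linear s1 s2 f by (rule f)
  obtain B where "finite B" "V \<subseteq> vs1.span B"
    using assms(2) unfolding vs1.fin_spanned_def by blast
  then show ?thesis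
    unfolding vs2.fin_spanned_def by (intro exI[of _ "f ` B"]) (auto simp: f.span_image)
qed

lemma dim_image_inj_on:
  assumes "Vector_Spaces.linear s1 s2 f" and "vs1.subspace V" "vs1.fin_spanned V"
    and "\<And>x. x \<in> V \<Longrightarrow> f x = 0 \<Longrightarrow> x = 0"
  shows "vs2.dim (f ` V) = vs1.dim V"
proof -
  have "{x \<in> V. f x = 0} = {0}"
    using assms vs1.subspace_0[OF assms(2)] linear_0[OF assms(1)] by auto
  moreover have "vs1.dim {0} = 0"
    using vs1.dim_le_card[of "{0}" "{}"] by simp
  ultimately show ?thesis
    using rank_nullity_on_subspace[OF assms(1-3)] by simp
qed

end

text \<open>
  Such a map replaces the projection to the quotient by \<open>M\<close>.
\<close>

lemma (in vector_space) exists_linear_with_kernel: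
  assumes "subspace M"
  shows "\<exists>p. Vector_Spaces.linear scale scale p \<and> (\<forall>x. p x = 0 \<longleftrightarrow> x \<in> M)"
proof -
  obtain A where A: "A \<subseteq> M" "\<not> dependent A" "M \<subseteq> span A"
    by (rule maximal_independent_subset)
  obtain B where B: "A \<subseteq> B" "\<not> dependent B" "UNIV \<subseteq> span B"
    by (rule maximal_independent_subset_extend[OF subset_UNIV A(2)])
  have M: "span A = M" using A span_minimal[OF A(1) assms] by (intro equalityI)
  obtain p where p: "Vector_Spaces.linear scale scale p"
    "\<And>x. x \<in> span A \<Longrightarrow> p x = 0" "\<And>x. x \<in> span (B - A) \<Longrightarrow> p x = x"
    using exists_projection_along_subbasis[OF B(1,2)] by auto
  interpret p: Vector_Spaces.linear scale scale p by (rule p(1))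
  have "p x = 0 \<longleftrightarrow> x \<in> M" for x
  proof -
    have "x \<in> span (A \<union> (B - A))" using B(1,3) by (simp add: Un_absorb1 subset_iff)
    then obtain a c where ac: "x = a + c" "a \<in> span A" "c \<in> span (B - A)"
      unfolding span_Un by auto
    then have px: "p x = c" by (simp add: p.add p(2,3))
    show ?thesis
    proof
      assume "p x = 0" then show "x \<in> M" using px ac M by simp
    next
      assume "x \<in> M" then show "p x = 0" using p(2) M by simp
    qed
  qed
  then show ?thesis using p(1) by blast
qed

text \<open>
  For \<open>g : V \<rightarrow> Y/M\<close>, the composition of \<open>f\<close> with the projection, the kernel is the preimage of \<open>M\<close>
  and the image is \<open>(f V + M)/M\<close>; so this is the rank-nullity formula for \<open>g\<close>.
\<close>

lemma (in vector_space_pair) dim_preimage: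
  assumes f: "Vector_Spaces.linear s1 s2 f" and V: "vs1.subspace V" "vs1.fin_spanned V"
    and M: "vs2.subspace M" "vs2.fin_spanned M"
  shows "vs1.dim {x \<in> V. f x \<in> M} + vs2.dim {y + m |y m. y \<in> f ` V \<and> m \<in> M} = vs1.dim V + vs2.dim M"
proof -
  interpret f: Vector_Spaces.linear s1 s2 f by (rule f)
  interpret q: vector_space_pair s2 s2 ..
  obtain p where p: "Vector_Spaces.linear s2 s2 p" "\<And>x. p x = 0 \<longleftrightarrow> x \<in> M"
    using vs2.exists_linear_with_kernel[OF M(1)] by auto
  interpret p: Vector_Spaces.linear s2 s2 p by (rule p(1))
  let ?W = "{y + m |y m. y \<in> f ` V \<and> m \<in> M}"
  have lin: "Vector_Spaces.linear s1 s2 (\<lambda>x. p (f x))"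
    using Vector_Spaces.linear_compose[OF f p(1)] by (simp add: o_def)
  have 1: "vs1.dim V = vs1.dim {x \<in> V. f x \<in> M} + vs2.dim ((\<lambda>x. p (f x)) ` V)"
    using rank_nullity_on_subspace[OF lin V] by (simp add: p(2))
  have fV: "vs2.subspace (f ` V)" by (rule f.subspace_image[OF V(1)])
  have W: "vs2.subspace ?W" by (rule vs2.subspace_sums[OF fV M(1)])
  have "vs2.fin_spanned (f ` V)" by (rule fin_spanned_image[OF f V(2)])
  then obtain A B where AB: "finite A" "f ` V \<subseteq> vs2.span A" "finite B" "M \<subseteq> vs2.span B"
    using M(2) unfolding vs2.fin_spanned_def by blast
  have "?W \<subseteq> vs2.span (A \<union> B)"
  proof safe
    fix x m assume "x \<in> V" "m \<in> M"
    then have "f x \<in> vs2.span (A \<union> B)" "m \<in> vs2.span (A \<union> B)"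
      using AB(2,4) vs2.span_mono[of A "A \<union> B"] vs2.span_mono[of B "A \<union> B"] by blast+
    then show "f x + m \<in> vs2.span (A \<union> B)" by (rule vs2.span_add)
  qed
  then have finW: "vs2.fin_spanned ?W"
    unfolding vs2.fin_spanned_def using AB(1,3) by blast
  have MW: "M \<subseteq> ?W" using vs2.subspace_0[OF fV] by force
  have "{x \<in> ?W. p x = 0} = M" using MW p(2) by blast
  moreover have "p ` ?W = (\<lambda>x. p (f x)) ` V"
  proof (intro equalityI subsetI)
    fix z assume "z \<in> p ` ?W"
    then obtain x m where "x \<in> V" "m \<in> M" "z = p (f x + m)" by auto
    then show "z \<in> (\<lambda>x. p (f x)) ` V" using p(2)[of m] by (auto simp: p.add)
  next
    fix z assume "z \<in> (\<lambda>x. p (f x)) ` V"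
    then obtain x where x: "x \<in> V" "z = p (f x)" by auto
    have "f x \<in> ?W" using x vs2.subspace_0[OF M(1)] by force
    then show "z \<in> p ` ?W" using x by auto
  qed
  ultimately have 2: "vs2.dim ?W = vs2.dim M + vs2.dim ((\<lambda>x. p (f x)) ` V)"
    using q.rank_nullity_on_subspace[OF p(1) W finW] by simp
  show ?thesis using 1 2 by simp
qed

section \<open>Dimensions of graded pieces\<close>

text \<open>
  \<open>S\<close> is a complex vector space through the constants, and so are the modules \<open>S\<^sup>2\<close> and \<open>S\<^sup>3\<close>.
  The names of the interpretations refer to polynomials and to vectors of polynomials.
\<close>

definition scal :: "complex \<Rightarrow> poly3 \<Rightarrow> poly3" where
  "scal c p = const c * p"

definition vscal :: "complex \<Rightarrow> poly3 ^ 'n \<Rightarrow> poly3 ^ 'n" where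
  "vscal c v = const c *s v"

global_interpretation P: vector_space scal
  by unfold_locales (simp_all add: scal_def ring_distribs const_add const_mult mult.assoc)

global_interpretation V: vector_space "vscal :: complex \<Rightarrow> poly3 ^ 'n::finite \<Rightarrow> poly3 ^ 'n"
  by unfold_locales (simp_all add: vscal_def vec_eq_iff ring_distribs const_add const_mult mult.assoc)

global_interpretation PP: vector_space_pair scal scal ..

global_interpretation VP: vector_space_pair "vscal :: complex \<Rightarrow> poly3 ^ 'n::finite \<Rightarrow> poly3 ^ 'n" scal ..

global_interpretation PV: vector_space_pair scal "vscal :: complex \<Rightarrow> poly3 ^ 'n::finite \<Rightarrow> poly3 ^ 'n" ..

global_interpretation VV: vector_space_pair "vscal :: complex \<Rightarrow> poly3 ^ 'm::finite \<Rightarrow> poly3 ^ 'm"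
  "vscal :: complex \<Rightarrow> poly3 ^ 'n::finite \<Rightarrow> poly3 ^ 'n" ..

lemma linear_scalI:
  assumes "\<And>p q. f (p + q) = f p + f q" "\<And>c p. f (const c * p) = const c * f p"
  shows "Vector_Spaces.linear scal scal f"
  using assms by (simp add: Vector_Spaces.linear_iff P.vector_space_axioms scal_def)

lemma subspace_S_deg: "P.subspace (S_deg k)"
  by (simp add: P.subspace_def scal_def S_deg_add const_mult_in_S_deg)

text \<open>
  A monomial \<open>x\<^sup>a y\<^sup>b z\<^sup>c\<close> of degree \<open>k\<close> is determined by \<open>a \<le> a + b \<le> k\<close>.
\<close>

lemma card_monomials:
  "finite {m :: monomial. mdeg m = k}" "2 * card {m :: monomial. mdeg m = k} = (k + 1) * (k + 2)"
proof -
  let ?A = "SIGMA s:{..k}. {..s}"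
  let ?f = "\<lambda>(s, a). Poly_Mapping.single 1 a + Poly_Mapping.single 2 (s - a) + Poly_Mapping.single 3 (k - s) :: monomial"
  let ?g = "\<lambda>m :: monomial. (Poly_Mapping.lookup m 1 + Poly_Mapping.lookup m 2, Poly_Mapping.lookup m 1)"
  have bij: "bij_betw ?f ?A {m. mdeg m = k}"
  proof (rule bij_betw_byWitness[where f' = ?g])
    show "\<forall>x\<in>?A. ?g (?f x) = x"
      by (auto simp: lookup_add lookup_single when_def)
    show "\<forall>m\<in>{m. mdeg m = k}. ?f (?g m) = m"
    proof
      fix m :: monomial assume "m \<in> {m. mdeg m = k}"
      then have "Poly_Mapping.lookup m 1 + Poly_Mapping.lookup m 2 + Poly_Mapping.lookup m 3 = k"
        by (simp add: mdeg_def sum_3)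
      then have "\<forall>i. Poly_Mapping.lookup (?f (?g m)) i = Poly_Mapping.lookup m i"
        unfolding forall_3 by (auto simp: lookup_add lookup_single when_def)
      then show "?f (?g m) = m" by (intro poly_mapping_eqI) simp
    qed
    show "?f ` ?A \<subseteq> {m. mdeg m = k}"
      by (auto simp: mdeg_add mdeg_single)
    show "?g ` {m. mdeg m = k} \<subseteq> ?A"
      by (auto simp: mdeg_def sum_3)
  qed
  then show "finite {m :: monomial. mdeg m = k}"
    using bij_betw_finite[OF bij] by simp
  have "card {m :: monomial. mdeg m = k} = card ?A"
    using bij_betw_same_card[OF bij] by simp
  also have "\<dots> = (\<Sum>s\<le>k. s + 1)" by simp
  also have "2 * \<dots> = (k + 1) * (k + 2)" by (induction k) simp_all
  finally show "2 * card {m :: monomial. mdeg m = k} = (k + 1) * (k + 2)" .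
qed

lemma fin_spanned_S_deg: "P.fin_spanned (S_deg k)"
  and two_dim_S_deg: "2 * P.dim (S_deg k) = (k + 1) * (k + 2)"
proof -
  let ?M = "{m :: monomial. mdeg m = k}"
  let ?s = "\<lambda>m :: monomial. Poly_Mapping.single m (1::complex)"
  have sc: "scal c (?s m) = Poly_Mapping.single m c" for c m
    by (simp add: scal_def const_def mult_single)
  have sp: "S_deg k \<subseteq> P.span (?s ` ?M)"
  proof
    fix p assume "p \<in> S_deg k"
    then show "p \<in> P.span (?s ` ?M)"
    proof (induction p rule: S_deg_induct)
      case (single m c)
      then have "?s m \<in> P.span (?s ` ?M)" by (intro P.span_base) auto
      then show ?case using P.span_scale[of "?s m" _ c] by (simp add: sc)
    qed (auto intro: P.span_zero P.span_add)
  qed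
  then show "P.fin_spanned (S_deg k)"
    unfolding P.fin_spanned_def using card_monomials(1) by blast
  have inj: "inj_on ?s A" for A
    by (rule inj_onI) (metis lookup_single_eq lookup_single_not_eq zero_neq_one)
  have "\<not> P.dependent (?s ` ?M)"
  proof (rule P.independent_if_scalars_zero)
    fix f x assume sum: "(\<Sum>x\<in>?s ` ?M. scal (f x) x) = 0" and "x \<in> ?s ` ?M"
    then obtain m where m: "m \<in> ?M" "x = ?s m" by blast
    have "0 = (\<Sum>n\<in>?M. Poly_Mapping.single n (f (?s n)))"
      using sum by (simp add: sum.reindex[OF inj] sc)
    then have "0 = Poly_Mapping.lookup (\<Sum>n\<in>?M. Poly_Mapping.single n (f (?s n))) m"
      by (metis lookup_zero)
    also have "\<dots> = f x"
      using m card_monomials(1) by (simp add: lookup_sum lookup_single when_def)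
    finally show "f x = 0" by simp
  qed (simp add: card_monomials(1))
  then have "card (?s ` ?M) = P.dim (S_deg k)"
    using sp by (intro P.basis_card_eq_dim) (auto intro: S_deg_single)
  then have "P.dim (S_deg k) = card ?M" by (simp add: card_image[OF inj])
  then show "2 * P.dim (S_deg k) = (k + 1) * (k + 2)" using card_monomials(2) by simp
qed

lemma multiples_of_S_deg:
  assumes "a \<noteq> 0"
  shows "P.dim ((*) a ` S_deg k) = P.dim (S_deg k)"
    and "P.subspace ((*) a ` S_deg k)" and "P.fin_spanned ((*) a ` S_deg k)"
proof -
  have lin: "Vector_Spaces.linear scal scal ((*) a)"
    by (rule linear_scalI) (simp_all add: ring_distribs)
  show "P.dim ((*) a ` S_deg k) = P.dim (S_deg k)"
    using assms by (intro PP.dim_image_inj_on[OF lin] subspace_S_deg fin_spanned_S_deg) simp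
  show "P.subspace ((*) a ` S_deg k)"
    by (rule PP.linear_subspace_image[OF lin subspace_S_deg])
  show "P.fin_spanned ((*) a ` S_deg k)"
    by (rule PP.fin_spanned_image[OF lin fin_spanned_S_deg])
qed

lemma linear_nth: "Vector_Spaces.linear vscal scal (\<lambda>v. v $ i)"
  by (simp add: Vector_Spaces.linear_iff P.vector_space_axioms V.vector_space_axioms scal_def vscal_def)

lemma linear_axis: "Vector_Spaces.linear scal vscal (axis i)"
  by (simp add: Vector_Spaces.linear_iff P.vector_space_axioms V.vector_space_axioms scal_def vscal_def
      vec_eq_iff axis_def)

text \<open>
  The dimension is computed by rank-nullity for the coordinate maps, with the coordinates outside
  of a growing index set required to vanish.
\<close>

lemma
  fixes U :: "'n::finite \<Rightarrow> poly3 set"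
  assumes sub: "\<And>i. P.subspace (U i)" and fin: "\<And>i. P.fin_spanned (U i)"
  shows subspace_vec: "V.subspace {v :: poly3 ^ 'n. \<forall>i. v $ i \<in> U i}"
    and fin_spanned_vec: "V.fin_spanned {v :: poly3 ^ 'n. \<forall>i. v $ i \<in> U i}"
    and dim_vec: "V.dim {v :: poly3 ^ 'n. \<forall>i. v $ i \<in> U i} = (\<Sum>i\<in>UNIV. P.dim (U i))"
proof -
  let ?W = "\<lambda>I. {v :: poly3 ^ 'n. \<forall>i. v $ i \<in> (if i \<in> I then U i else {0})}"
  have subW: "V.subspace (?W I)" for I
    using sub by (auto simp: V.subspace_def P.subspace_def vscal_def scal_def)
  show "V.subspace {v :: poly3 ^ 'n. \<forall>i. v $ i \<in> U i}"
    using subW[of UNIV] by simp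
  show finU: "V.fin_spanned {v :: poly3 ^ 'n. \<forall>i. v $ i \<in> U i}"
  proof -
    obtain B where B: "\<And>i. finite (B i)" "\<And>i. U i \<subseteq> P.span (B i)"
      using fin unfolding P.fin_spanned_def by metis
    let ?B = "\<Union>i. (axis i ` B i :: (poly3 ^ 'n) set)"
    have "v \<in> V.span ?B" if v: "\<forall>i. v $ i \<in> U i" for v :: "poly3 ^ 'n"
    proof -
      have "axis i (v $ i) \<in> V.span ?B" for i
      proof -
        have "axis i (v $ i) \<in> axis i ` P.span (B i)" using v B(2) by blast
        also have "\<dots> = V.span (axis i ` B i)"
          by (rule PV.linear_span_image[OF linear_axis, symmetric])
        also have "\<dots> \<subseteq> V.span ?B" by (rule V.span_mono) blast
        finally show ?thesis .
      qed
      then have "(\<Sum>i\<in>UNIV. axis i (v $ i)) \<in> V.span ?B" by (intro V.span_sum)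
      also have "(\<Sum>i\<in>UNIV. axis i (v $ i)) = v" by (simp add: vec_eq_iff axis_def)
      finally show ?thesis .
    qed
    then show ?thesis
      unfolding V.fin_spanned_def using B(1) by (intro exI[of _ ?B]) auto
  qed
  have finW: "V.fin_spanned (?W I)" for I
  proof (rule V.fin_spanned_subset[OF finU], safe)
    fix v :: "poly3 ^ 'n" and i assume "\<forall>i. v $ i \<in> (if i \<in> I then U i else {0})"
    then have "v $ i \<in> (if i \<in> I then U i else {0})" by blast
    then show "v $ i \<in> U i" using P.subspace_0[OF sub[of i]] by (auto split: if_splits)
  qed
  have "V.dim (?W I) = (\<Sum>i\<in>I. P.dim (U i))" if "finite I" for I
    using that
  proof (induction I rule: finite_induct)
    case empty
    have "?W {} = {0}" by (auto simp: vec_eq_iff)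
    then show ?case using V.dim_le_card[of "{0}" "{}"] by simp
  next
    case (insert j I)
    have "{v \<in> ?W (insert j I). v $ j = 0} = ?W I"
      using insert(2) sub P.subspace_0 by (fastforce split: if_splits)
    moreover have "(\<lambda>v. v $ j) ` ?W (insert j I) = U j"
    proof (intro equalityI subsetI)
      fix p assume "p \<in> U j"
      then have "axis j p \<in> ?W (insert j I)" using sub P.subspace_0 by (auto simp: axis_def)
      then show "p \<in> (\<lambda>v. v $ j) ` ?W (insert j I)" by (intro image_eqI[of _ _ "axis j p"]) (auto simp: axis_def)
    qed (auto dest: spec[of _ j])
    ultimately show ?case
      using VP.rank_nullity_on_subspace[OF linear_nth[of j] subW[of "insert j I"] finW] insert by simp
  qed
  from this[of UNIV] show "V.dim {v :: poly3 ^ 'n. \<forall>i. v $ i \<in> U i} = (\<Sum>i\<in>UNIV. P.dim (U i))"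
    by simp
qed

definition VS_deg :: "nat \<Rightarrow> (poly3 ^ 3) set" where
  "VS_deg k = {v. \<forall>i. v $ i \<in> S_deg k}"

lemma subspace_VS_deg: "V.subspace (VS_deg k)"
  unfolding VS_deg_def by (rule subspace_vec[OF subspace_S_deg fin_spanned_S_deg])

lemma fin_spanned_VS_deg: "V.fin_spanned (VS_deg k)"
  unfolding VS_deg_def by (rule fin_spanned_vec[OF subspace_S_deg fin_spanned_S_deg])

lemma dim_VS_deg: "V.dim (VS_deg k) = 3 * P.dim (S_deg k)"
  unfolding VS_deg_def dim_vec[OF subspace_S_deg fin_spanned_S_deg] by simp

text \<open>
  The isomorphism is only required to map homogeneous elements to homogeneous ones. To see that it
  reaches every relation of degree \<open>k\<close> from homogeneous arguments of the right degrees, note that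
  taking the component of degree \<open>k\<close> commutes with the isomorphism, as one checks on monomials.
\<close>

lemma dim_AR_if_graded_iso:
  assumes \<phi>: "AR_graded_iso d1 d2 f \<phi>" and k: "d1 \<le> k" "d2 \<le> k"
  shows "V.dim (AR f \<inter> VS_deg k) = P.dim (S_deg (k - d1)) + P.dim (S_deg (k - d2))"
proof -
  have hom: "module_hom (*s) (*s) \<phi>" and bij: "bij_betw \<phi> UNIV (AR f)"
    and deg: "\<And>k g i. g $ 1 \<in> S_shift d1 k \<Longrightarrow> g $ 2 \<in> S_shift d2 k \<Longrightarrow> \<phi> g $ i \<in> S_deg k"
    using \<phi> by (auto simp: AR_graded_iso_def)
  interpret module_hom "(*s)" "(*s)" \<phi> by (rule hom)
  note \<phi>_add = add
  let ?U = "\<lambda>i::2. if i = 1 then S_deg (k - d1) else S_deg (k - d2)"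
  let ?G = "{g :: poly3 ^ 2. \<forall>i. g $ i \<in> ?U i}"
  have lin: "Vector_Spaces.linear vscal vscal \<phi>"
    by (simp add: Vector_Spaces.linear_iff V.vector_space_axioms vscal_def add scale)
  have U: "P.subspace (?U i)" "P.fin_spanned (?U i)" for i
    by (simp_all add: subspace_S_deg fin_spanned_S_deg)
  have comp: "\<exists>g1 g2. g1 \<in> S_deg (k - d1) \<and> g2 \<in> S_deg (k - d2) \<and>
      (\<forall>i. homog_component k (\<phi> g $ i) = \<phi> (vector [g1, g2]) $ i)" for g
  proof -
    have vec: "vector [a, b] = (axis 1 a + axis 2 b :: poly3 ^ 2)" for a b
      by (simp add: vec_eq_iff forall_2 axis_def)
    have *: "\<forall>i. homog_component k (\<phi> (axis j a) $ i) = \<phi> (axis j (homog_component (k - e) a)) $ i"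
      if je: "(j, e) = (1, d1) \<or> (j, e) = (2, d2)" for j :: 2 and e and a
    proof (induction a rule: poly3_induct)
      case (add p q)
      have "axis j (p + q) = axis j p + axis j q" for p q :: poly3
        by (simp add: vec_eq_iff axis_def)
      with add show ?case by (simp add: homog_component_add \<phi>_add)
    next
      case (single m c)
      let ?a = "Poly_Mapping.single m c"
      have a: "?a \<in> S_deg (mdeg m)" by (rule S_deg_single) simp
      have z: "axis j 0 = (0 :: poly3 ^ 2)" by (simp add: vec_eq_iff axis_def)
      have "\<phi> (axis j ?a) $ i \<in> S_deg (mdeg m + e)" for i
        using je a by (intro deg) (auto simp: axis_def S_shift_def)
      then have "homog_component k (\<phi> (axis j ?a) $ i) = (if k = mdeg m + e then \<phi> (axis j ?a) $ i else 0)" for i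
        by (rule homog_component_S_deg)
      moreover have "k - e = mdeg m \<longleftrightarrow> k = mdeg m + e" using je k by auto
      ultimately show ?case
        by (simp add: homog_component_S_deg[OF a] z zero)
    qed
    show ?thesis
    proof (intro exI conjI allI)
      fix i
      have "g = axis 1 (g $ 1) + axis 2 (g $ 2)"
        by (simp add: vec_eq_iff forall_2 axis_def)
      then have "homog_component k (\<phi> g $ i) = homog_component k (\<phi> (axis 1 (g $ 1)) $ i + \<phi> (axis 2 (g $ 2)) $ i)"
        by (metis add vector_add_component)
      also have "\<dots> = \<phi> (vector [homog_component (k - d1) (g $ 1), homog_component (k - d2) (g $ 2)]) $ i"
        using *[of 1 d1] *[of 2 d2] by (simp add: homog_component_add vec add)
      finally show "homog_component k (\<phi> g $ i) = \<phi> (vector [homog_component (k - d1) (g $ 1), homog_component (k - d2) (g $ 2)]) $ i" .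
    qed (rule homog_component_in_S_deg)+
  qed
  have "\<phi> ` ?G = AR f \<inter> VS_deg k"
  proof (intro equalityI subsetI)
    fix v assume "v \<in> \<phi> ` ?G"
    then obtain g where g: "v = \<phi> g" "g $ 1 \<in> S_deg (k - d1)" "g $ 2 \<in> S_deg (k - d2)"
      by (auto simp: forall_2)
    then have "v $ i \<in> S_deg k" for i using k deg[of g k i] by (simp add: S_shift_def)
    moreover have "v \<in> AR f" using bij g(1) by (auto simp: bij_betw_def)
    ultimately show "v \<in> AR f \<inter> VS_deg k" by (simp add: VS_deg_def)
  next
    fix v assume v: "v \<in> AR f \<inter> VS_deg k"
    then obtain g where g: "v = \<phi> g" using bij by (auto simp: bij_betw_def)
    obtain g1 g2 where g12: "g1 \<in> S_deg (k - d1)" "g2 \<in> S_deg (k - d2)"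
      "\<And>i. homog_component k (v $ i) = \<phi> (vector [g1, g2]) $ i"
      using comp[of g] g by auto
    have "homog_component k (v $ i) = v $ i" for i
      using v homog_component_S_deg[of "v $ i" k k] by (simp add: VS_deg_def)
    then have "v = \<phi> (vector [g1, g2])" using g12(3) by (simp add: vec_eq_iff)
    then show "v \<in> \<phi> ` ?G" using g12 by (auto simp: forall_2)
  qed
  moreover have "V.dim (\<phi> ` ?G) = V.dim ?G"
  proof (rule VV.dim_image_inj_on[OF lin subspace_vec[OF U] fin_spanned_vec[OF U]])
    fix x assume "\<phi> x = 0"
    then show "x = 0" using bij zero by (metis UNIV_I bij_betw_def inj_onD)
  qed
  ultimately show ?thesis
    using dim_vec[of ?U, OF U] by (simp add: sum_2)
qed

section \<open>Linear forms and polynomial vector fields\<close>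

text \<open>
  Linear forms are identified with their coefficient vectors; concurrency of lines then becomes a
  statement about cross products.
\<close>

definition coef :: "poly3 \<Rightarrow> complex ^ 3" where
  "coef l = (\<chi> i. Poly_Mapping.lookup l (Poly_Mapping.single i 1))"

lemma coef_add: "coef (l + m) = coef l + coef m"
  by (simp add: coef_def vec_eq_iff lookup_add)

lemma lookup_const_mult: "Poly_Mapping.lookup (const c * p) m = c * Poly_Mapping.lookup p m"
proof (induction p rule: poly3_induct)
  case (single n b)
  then show ?case by (simp add: const_def mult_single lookup_single when_def)
qed (simp add: ring_distribs lookup_add)

lemma coef_const_mult: "coef (const c * l) = c *s coef l"
  by (simp add: coef_def vec_eq_iff lookup_const_mult)

lemma pdiff_linear_form:
  assumes "l \<in> S_deg 1"
  shows "pdiff i l = const (coef l $ i)"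
proof -
  obtain c where c: "pdiff i l = const c"
    using S_deg_0E pdiff_S_deg[OF assms, of i] by (metis diff_self_eq_0)
  then have "c = Poly_Mapping.lookup (pdiff i l) 0" by (simp add: const_def)
  also have "\<dots> = coef l $ i" unfolding lookup_pdiff by (simp add: coef_def)
  finally show ?thesis using c by simp
qed

lemma linear_form_eq:
  assumes "l \<in> S_deg 1"
  shows "l = (\<Sum>i\<in>UNIV. const (coef l $ i) * var i)"
  using Euler_identity[OF assms] by (simp add: pdiff_linear_form[OF assms] mult.commute)

lemma coef_inject: "l \<in> S_deg 1 \<Longrightarrow> m \<in> S_deg 1 \<Longrightarrow> coef l = coef m \<longleftrightarrow> l = m"
  using linear_form_eq by metis

lemma coef_var: "coef (var i) $ j = (if i = j then 1 else 0)"
proof -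
  have "Poly_Mapping.single i (1::nat) = Poly_Mapping.single j 1 \<longleftrightarrow> i = j"
    by (metis lookup_single_eq lookup_single_not_eq zero_neq_one)
  then show ?thesis by (simp add: coef_def var_def lookup_single when_def)
qed

definition cross :: "complex ^ 3 \<Rightarrow> complex ^ 3 \<Rightarrow> complex ^ 3" where
  "cross a b = vector [a $ 2 * b $ 3 - a $ 3 * b $ 2, a $ 3 * b $ 1 - a $ 1 * b $ 3,
                       a $ 1 * b $ 2 - a $ 2 * b $ 1]"

definition dot :: "complex ^ 3 \<Rightarrow> complex ^ 3 \<Rightarrow> complex" where
  "dot a b = (\<Sum>i\<in>UNIV. a $ i * b $ i)"

definition triple_product :: "complex ^ 3 \<Rightarrow> complex ^ 3 \<Rightarrow> complex ^ 3 \<Rightarrow> complex" where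
  "triple_product a b c = dot (cross a b) c"

lemmas vec3_simps = cross_def dot_def triple_product_def sum_3 forall_3 vec_eq_iff

lemma cramer:
  "triple_product a b c *s l = triple_product l b c *s a + triple_product a l c *s b + triple_product a b l *s c"
  by (simp add: vec3_simps) (intro conjI; algebra)

lemma linear_form_in_span:
  assumes "a \<in> S_deg 1" "b \<in> S_deg 1" "c \<in> S_deg 1" "l \<in> S_deg 1"
    and D: "triple_product (coef a) (coef b) (coef c) \<noteq> 0"
  shows "\<exists>x y z. l = const x * a + const y * b + const z * c"
proof -
  let ?D = "triple_product (coef a) (coef b) (coef c)"
  let ?x = "triple_product (coef l) (coef b) (coef c) / ?D" and ?y = "triple_product (coef a) (coef l) (coef c) / ?D"
    and ?z = "triple_product (coef a) (coef b) (coef l) / ?D"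
  have "?D *s coef l = ?D *s (?x *s coef a + ?y *s coef b + ?z *s coef c)"
    using D by (subst cramer) (simp add: vec_eq_iff ring_distribs)
  then have "coef l = ?x *s coef a + ?y *s coef b + ?z *s coef c"
    using D vector_mul_lcancel[of ?D] by blast
  then have "coef l = coef (const ?x * a + const ?y * b + const ?z * c)"
    by (simp add: coef_add coef_const_mult)
  then have "l = const ?x * a + const ?y * b + const ?z * c"
    using assms by (subst (asm) coef_inject) (auto intro!: S_deg_add const_mult_in_S_deg)
  then show ?thesis by blast
qed

text \<open>
  Three independent linear forms generate the ideal of the variables, and the Euler identity
  decomposes \<open>p\<close> with respect to the variables.
\<close>

lemma S_deg_Suc_decompose:
  assumes "a \<in> S_deg 1" "b \<in> S_deg 1" "c \<in> S_deg 1" "triple_product (coef a) (coef b) (coef c) \<noteq> 0"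
    and p: "p \<in> S_deg (Suc k)"
  obtains u v w where "u \<in> S_deg k" "v \<in> S_deg k" "w \<in> S_deg k" "p = a * u + b * v + c * w"
proof -
  have "\<forall>i. \<exists>x y z. var i = const x * a + const y * b + const z * c"
    using linear_form_in_span[OF assms(1-3) var_in_S_deg assms(4)] by blast
  then obtain x y z where xyz: "\<And>i. var i = const (x i) * a + const (y i) * b + const (z i) * c"
    by metis
  define q where "q = (\<lambda>i. const (1 / of_nat (Suc k)) * pdiff i p)"
  have q: "q i \<in> S_deg k" for i
    using pdiff_S_deg[OF p, of i] unfolding q_def by (intro const_mult_in_S_deg) simp
  have "const (1 / of_nat (Suc k)) * (of_nat (Suc k) * p) = p"
    by (simp only: const_of_nat[symmetric] mult.assoc[symmetric] const_mult[symmetric]) (simp del: of_nat_Suc)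
  then have "p = const (1 / of_nat (Suc k)) * (\<Sum>i\<in>UNIV. var i * pdiff i p)"
    unfolding Euler_identity[OF p] by simp
  also have "\<dots> = (\<Sum>i\<in>UNIV. var i * q i)"
    by (simp add: q_def sum_distrib_left algebra_simps)
  also have "\<dots> = a * (\<Sum>i\<in>UNIV. const (x i) * q i) + b * (\<Sum>i\<in>UNIV. const (y i) * q i)
      + c * (\<Sum>i\<in>UNIV. const (z i) * q i)"
    by (subst xyz) (simp add: sum_distrib_left sum.distrib[symmetric] algebra_simps)
  finally have "p = \<dots>" .
  then show ?thesis
    using q by (intro that[of "\<Sum>i\<in>UNIV. const (x i) * q i" "\<Sum>i\<in>UNIV. const (y i) * q i"
      "\<Sum>i\<in>UNIV. const (z i) * q i"]) (auto intro!: S_deg_sum const_mult_in_S_deg)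
qed

text \<open>
  Modulo \<open>a\<close> and \<open>b\<close> the ring is a polynomial ring in one variable, and each \<open>c\<^sub>j\<close> becomes a nonzero
  multiple of that variable.
\<close>

lemma S_deg_decompose_prod:
  assumes "a \<in> S_deg 1" "b \<in> S_deg 1" and "\<And>j. j < m \<Longrightarrow> c j \<in> S_deg 1"
    and "\<And>j. j < m \<Longrightarrow> triple_product (coef a) (coef b) (coef (c j)) \<noteq> 0"
    and p: "p \<in> S_deg (k + m)"
  shows "\<exists>u v w. u \<in> S_deg (k + m - 1) \<and> v \<in> S_deg (k + m - 1) \<and> w \<in> S_deg k \<and>
           p = a * u + b * v + (\<Prod>j<m. c j) * w"
  using assms(3-5)
proof (induction m arbitrary: k)
  case 0
  then show ?case by (intro exI[of _ 0] exI[of _ p]) simp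
next
  case (Suc m)
  obtain u v w where uvw: "u \<in> S_deg (Suc k + m - 1)" "v \<in> S_deg (Suc k + m - 1)" "w \<in> S_deg (Suc k)"
    "p = a * u + b * v + (\<Prod>j<m. c j) * w"
    using Suc.IH[of "Suc k"] Suc.prems by auto
  obtain u' v' w' where uvw': "u' \<in> S_deg k" "v' \<in> S_deg k" "w' \<in> S_deg k" "w = a * u' + b * v' + c m * w'"
    by (rule S_deg_Suc_decompose[OF assms(1,2) _ _ uvw(3), of "c m"]) (use Suc.prems in auto)
  have c: "(\<Prod>j<m. c j) \<in> S_deg m"
    using S_deg_prod[of "{..<m}" c] Suc.prems(1) by simp
  have "p = a * (u + (\<Prod>j<m. c j) * u') + b * (v + (\<Prod>j<m. c j) * v') + (\<Prod>j<Suc m. c j) * w'"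
    unfolding uvw(4) uvw'(4) by (simp add: algebra_simps)
  moreover have "u + (\<Prod>j<m. c j) * u' \<in> S_deg (k + Suc m - 1)"
    using S_deg_mult[OF c uvw'(1)] uvw(1) by (auto intro!: S_deg_add simp: add.commute)
  moreover have "v + (\<Prod>j<m. c j) * v' \<in> S_deg (k + Suc m - 1)"
    using S_deg_mult[OF c uvw'(2)] uvw(2) by (auto intro!: S_deg_add simp: add.commute)
  ultimately show ?case using uvw'(3) by blast
qed

text \<open>
  A triple of polynomials is regarded as the vector field \<open>\<theta>\<^sub>1 \<partial>\<^sub>x + \<theta>\<^sub>2 \<partial>\<^sub>y + \<theta>\<^sub>3 \<partial>\<^sub>z\<close>, that is, as a derivation.
  Then \<open>AR(f)\<close> consists of the fields that kill \<open>f\<close>.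
\<close>

definition apply_field :: "poly3 ^ 3 \<Rightarrow> poly3 \<Rightarrow> poly3" where
  "apply_field \<theta> p = (\<Sum>i\<in>UNIV. \<theta> $ i * pdiff i p)"

lemma apply_field_add: "apply_field \<theta> (p + q) = apply_field \<theta> p + apply_field \<theta> q"
  by (simp add: apply_field_def pdiff_add ring_distribs sum.distrib)

lemma apply_field_mult: "apply_field \<theta> (p * q) = apply_field \<theta> p * q + p * apply_field \<theta> q"
  by (simp add: apply_field_def pdiff_mult ring_distribs sum.distrib sum_distrib_left sum_distrib_right algebra_simps)

lemma apply_field_const [simp]: "apply_field \<theta> (const c) = 0"
  by (simp add: apply_field_def)

lemma apply_field_1 [simp]: "apply_field \<theta> 1 = 0"
  using apply_field_const[of \<theta> 1] by simp

lemma apply_field_of_nat [simp]: "apply_field \<theta> (of_nat n) = 0"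
  using apply_field_const[of \<theta> "of_nat n"] by (simp add: const_of_nat)

lemma apply_field_of_nat_mult: "apply_field \<theta> (of_nat n * p) = of_nat n * apply_field \<theta> p"
  by (simp add: apply_field_mult flip: const_of_nat)

lemma apply_field_prod:
  assumes "finite I"
  shows "apply_field \<theta> (prod p I) = (\<Sum>i\<in>I. apply_field \<theta> (p i) * prod p (I - {i}))"
  using assms
proof (induction I rule: finite_induct)
  case (insert j I)
  have "prod p (insert j I - {i}) = p j * prod p (I - {i})" if "i \<in> I" for i
  proof -
    have "insert j I - {i} = insert j (I - {i})" using insert that by auto
    then show ?thesis using insert by simp
  qed
  then show ?case using insert by (simp add: apply_field_mult sum_distrib_left algebra_simps)
qed simp

lemma apply_field_vscal: "apply_field (\<chi> i. p * \<theta> $ i) q = p * apply_field \<theta> q"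
  by (simp add: apply_field_def sum_distrib_left mult.assoc)

lemma linear_app: "Vector_Spaces.linear vscal scal (\<lambda>\<theta>. apply_field \<theta> p)"
  by (simp add: Vector_Spaces.linear_iff P.vector_space_axioms V.vector_space_axioms scal_def vscal_def
      apply_field_def ring_distribs sum.distrib sum_distrib_left mult.assoc)

lemma apply_field_in_S_deg:
  assumes "\<And>i. \<theta> $ i \<in> S_deg k" "l \<in> S_deg 1"
  shows "apply_field \<theta> l \<in> S_deg k"
  unfolding apply_field_def
proof (rule S_deg_sum)
  fix i
  show "\<theta> $ i * pdiff i l \<in> S_deg k"
    using S_deg_mult[OF assms(1) pdiff_S_deg[OF assms(2)], of i i] by simp
qed

lemma apply_field_constant_field:
  assumes "\<And>i. v $ i \<in> S_deg 0" "p \<in> S_deg k"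
  shows "apply_field v p \<in> S_shift 1 k"
proof (cases "k = 0")
  case True
  then show ?thesis using assms by (simp add: apply_field_def pdiff_S_deg_0 S_shift_def)
next
  case False
  have "v $ i * pdiff i p \<in> S_deg (k - 1)" for i
    using S_deg_mult[OF assms(1) pdiff_S_deg[OF assms(2)], of i i] by simp
  then show ?thesis using False by (auto simp: apply_field_def S_shift_def intro!: S_deg_sum)
qed

text \<open>
  If the \<open>i\<close>-th component of \<open>a \<times> b\<close> is nonzero, a multiple of \<open>e\<^sub>i \<times> a\<close> will do, because
  \<open>b \<cdot> (e\<^sub>i \<times> a) = e\<^sub>i \<cdot> (a \<times> b)\<close>.
\<close>

lemma exists_dual_vector:
  assumes "cross a b \<noteq> 0"
  obtains v where "dot a v = 0" "dot b v = 1"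
proof -
  obtain i where i: "cross a b $ i \<noteq> 0"
    using assms by (auto simp: vec_eq_iff)
  let ?w = "cross (axis i 1) a"
  have "dot a ?w = 0" "dot b ?w = cross a b $ i"
    using exhaust_3[of i] by (auto simp: vec3_simps axis_def algebra_simps)
  moreover have "dot c (t *s w) = t * dot c w" for c t w
    by (simp add: dot_def sum_distrib_left algebra_simps)
  ultimately show ?thesis
    using i by (intro that[of "(1 / cross a b $ i) *s ?w"]) simp_all
qed

lemma exists_constant_field:
  assumes ab: "a \<in> S_deg 1" "b \<in> S_deg 1" "cross (coef a) (coef b) \<noteq> 0"
  obtains v where "\<And>i. v $ i \<in> S_deg 0" "apply_field v a = 0" "apply_field v b = 1"
proof -
  obtain v where v: "dot (coef a) v = 0" "dot (coef b) v = 1"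
    by (rule exists_dual_vector[OF ab(3)])
  have apply_field: "apply_field (\<chi> j. const (v $ j)) l = const (dot (coef l) v)" if "l \<in> S_deg 1" for l
    using that by (simp add: apply_field_def pdiff_linear_form dot_def sum_3 const_add const_mult mult.commute)
  show ?thesis
    using v by (intro that[of "\<chi> j. const (v $ j)"]) (simp_all add: const_in_S_deg apply_field[OF ab(1)] apply_field[OF ab(2)])
qed

lemma S_shift_mult: "p \<in> S_deg l \<Longrightarrow> q \<in> S_shift 1 k \<Longrightarrow> p * q \<in> S_shift 1 (l + k)"
  using S_deg_mult[of p l q "k - 1"] by (auto simp: S_shift_def split: if_splits)

text \<open>
  The constant field \<open>v\<close> kills \<open>a\<close> and is \<open>1\<close> on \<open>b\<close>. Applying it to the equation
  \<open>j p + b v(p) = a c\<close> gives an equation of the same form for \<open>v(p)\<close>, with \<open>j + 1\<close> instead of \<open>j\<close>.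
  Since \<open>v\<close> lowers the degree, induction shows that \<open>a\<close> divides \<open>v(p)\<close>, and then the equation
  itself shows that \<open>a\<close> divides \<open>p\<close>. Allowing an arbitrary \<open>j \<noteq> 0\<close> is what makes the induction work,
  and characteristic zero allows the division by \<open>j\<close>.
\<close>

lemma divisible_if_derivation_equation:
  assumes v: "\<And>i. v $ i \<in> S_deg 0" "apply_field v a = 0" "apply_field v b = 1" and b: "b \<in> S_deg 1"
    and "of_nat j * p + b * apply_field v p = a * c" "j \<noteq> 0" "p \<in> S_deg k" "c \<in> S_shift 1 k"
  shows "p \<in> (*) a ` S_shift 1 k"
  using assms(5-8)
proof (induction k arbitrary: j p c)
  have divide: "p = a * (const (1 / of_nat j) * e)" if "of_nat j * p = a * e" "j \<noteq> 0" for j :: nat and p e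
  proof -
    have "p = const (1 / of_nat j) * (of_nat j * p)"
      using that(2) by (simp only: const_of_nat[symmetric] mult.assoc[symmetric] const_mult[symmetric]) simp
    also have "\<dots> = a * (const (1 / of_nat j) * e)" unfolding that(1) by (simp add: algebra_simps)
    finally show ?thesis .
  qed
  {
    case 0
    have "apply_field v p = 0" using apply_field_constant_field[OF v(1) 0(3)] by (simp add: S_shift_def)
    then have "of_nat j * p = a * 0" using 0 by (simp add: S_shift_def)
    then show ?case using divide[of j p 0] 0(2) by (simp add: S_shift_def)
  next
    case (Suc k)
    have p': "apply_field v p \<in> S_deg k" and c: "c \<in> S_deg k"
      using apply_field_constant_field[OF v(1) Suc.prems(3)] Suc.prems(4) by (simp_all add: S_shift_def)
    have "apply_field v (of_nat j * p + b * apply_field v p) = apply_field v (a * c)"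
      using Suc.prems(1) by simp
    then have "of_nat (Suc j) * apply_field v p + b * apply_field v (apply_field v p) = a * apply_field v c"
      by (simp add: apply_field_add apply_field_mult apply_field_of_nat_mult v ring_distribs algebra_simps)
    then have "apply_field v p \<in> (*) a ` S_shift 1 k"
      by (rule Suc.IH[OF _ _ p' apply_field_constant_field[OF v(1) c]]) simp
    then obtain e where e: "apply_field v p = a * e" "e \<in> S_shift 1 k" by blast
    have "of_nat j * p = a * (c - b * e)"
      using Suc.prems(1) unfolding e(1) by (simp add: algebra_simps)
    then have "p = a * (const (1 / of_nat j) * (c - b * e))"
      using divide Suc.prems(2) by blast
    moreover have "b * e \<in> S_deg k" using S_shift_mult[OF b e(2)] by (simp add: S_shift_def)
    ultimately show ?case
      using c by (auto simp: S_shift_def intro!: const_mult_in_S_deg S_deg_diff)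
  }
qed

text \<open>
  A linear form is prime. Applying to \<open>b p = a c\<close> a constant field that kills \<open>a\<close> and is \<open>1\<close> on \<open>b\<close>
  leads to the situation of the previous lemma, and the quotient comes out homogeneous.
\<close>

lemma linear_form_divides:
  assumes "a \<in> S_deg 1" "b \<in> S_deg 1" "cross (coef a) (coef b) \<noteq> 0"
    and "b * p = a * c" "p \<in> S_deg k" "c \<in> S_deg k"
  shows "p \<in> (*) a ` S_shift 1 k"
proof -
  obtain v where v: "\<And>i. v $ i \<in> S_deg 0" "apply_field v a = 0" "apply_field v b = 1"
    using exists_constant_field[OF assms(1-3)] by metis
  have "apply_field v (b * p) = apply_field v (a * c)" using assms(4) by simp
  then have "of_nat 1 * p + b * apply_field v p = a * apply_field v c"
    by (simp add: apply_field_mult v)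
  then show ?thesis
    by (rule divisible_if_derivation_equation[OF v assms(2) _ _ assms(5) apply_field_constant_field[OF v(1) assms(6)]]) simp
qed

lemma linear_form_divides_prod:
  assumes "finite J" and "a \<in> S_deg 1"
    and "\<And>j. j \<in> J \<Longrightarrow> b j \<in> S_deg 1" "\<And>j. j \<in> J \<Longrightarrow> cross (coef a) (coef (b j)) \<noteq> 0"
    and "prod b J * p = a * c" "p \<in> S_deg k" "c \<in> S_shift 1 (card J + k)"
  shows "p \<in> (*) a ` S_shift 1 k"
  using assms(1,3-)
proof (induction J arbitrary: c rule: finite_induct)
  case (insert j J)
  have "prod b J * p \<in> S_deg (card J + k)"
    using insert by (intro S_deg_mult S_deg_prod) auto
  moreover have "b j * (prod b J * p) = a * c" "c \<in> S_deg (card J + k)"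
    using insert by (simp_all add: mult.assoc S_shift_def)
  ultimately have "prod b J * p \<in> (*) a ` S_shift 1 (card J + k)"
    by (intro linear_form_divides[OF assms(2), of "b j" _ c]) (use insert.prems in auto)
  then obtain c' where "prod b J * p = a * c'" "c' \<in> S_shift 1 (card J + k)" by blast
  then show ?case using insert.IH insert.prems by blast
qed auto

section \<open>Vector fields tangent to an arrangement\<close>

definition zeros :: "complex ^ 3 \<Rightarrow> (complex ^ 3) set" where
  "zeros a = {v. dot a v = 0}"

text \<open>
  Both \<open>v\<close> and \<open>a \<times> b\<close> are orthogonal to \<open>a\<close> and \<open>b\<close>, and \<open>v \<times> (a \<times> b) = a (v \<cdot> b) - b (v \<cdot> a)\<close>.
\<close>

lemma common_zero_parallel_cross:
  assumes "dot a v = 0" "dot b v = 0"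
  shows "v $ i * cross a b $ j = v $ j * cross a b $ i"
proof -
  have "v $ 1 * cross a b $ 2 = v $ 2 * cross a b $ 1"
    using assms unfolding cross_def dot_def sum_3 vector_3 by algebra
  moreover have "v $ 1 * cross a b $ 3 = v $ 3 * cross a b $ 1"
    using assms unfolding cross_def dot_def sum_3 vector_3 by algebra
  moreover have "v $ 2 * cross a b $ 3 = v $ 3 * cross a b $ 2"
    using assms unfolding cross_def dot_def sum_3 vector_3 by algebra
  ultimately show ?thesis
    using exhaust_3[of i] exhaust_3[of j] by auto
qed

lemma zeros_cross: "cross a b \<in> zeros a \<inter> zeros b"
  by (simp add: zeros_def vec3_simps) (intro conjI; algebra)

lemma zeros_Int_subset_iff:
  assumes "cross a b \<noteq> 0"
  shows "zeros a \<inter> zeros b \<subseteq> zeros c \<longleftrightarrow> triple_product a b c = 0"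
proof
  assume "zeros a \<inter> zeros b \<subseteq> zeros c"
  then have "dot c (cross a b) = 0" using zeros_cross[of a b] by (auto simp: zeros_def)
  then show "triple_product a b c = 0" by (simp add: triple_product_def dot_def mult.commute)
next
  assume 0: "triple_product a b c = 0"
  obtain i where i: "cross a b $ i \<noteq> 0" using assms by (auto simp: vec_eq_iff)
  show "zeros a \<inter> zeros b \<subseteq> zeros c"
  proof
    fix v assume "v \<in> zeros a \<inter> zeros b"
    then have "v $ j * cross a b $ i = v $ i * cross a b $ j" for j
      by (intro common_zero_parallel_cross) (auto simp: zeros_def)
    then have "dot c v * cross a b $ i = v $ i * triple_product a b c"
      by (simp add: triple_product_def dot_def sum_distrib_left sum_distrib_right algebra_simps)
    then show "v \<in> zeros c" using 0 i by (simp add: zeros_def)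
  qed
qed

lemma zeros_Int_eq_iff:
  assumes "cross a b \<noteq> 0" "cross a c \<noteq> 0"
  shows "zeros a \<inter> zeros b = zeros a \<inter> zeros c \<longleftrightarrow> triple_product a b c = 0"
proof -
  have "triple_product a c b = - triple_product a b c"
    by (simp add: vec3_simps algebra_simps)
  then have "triple_product a c b = 0 \<longleftrightarrow> triple_product a b c = 0" by simp
  then show ?thesis
    using zeros_Int_subset_iff[OF assms(1), of c] zeros_Int_subset_iff[OF assms(2), of b] by blast
qed

text \<open>
  The elements of degree \<open>k\<close> in the ideals generated by \<open>a\<close> and by the products of all but one of
  \<open>b\<^sub>0, \<dots>, b\<^bsub>n-1\<^esub>\<close>. For \<open>k \<ge> n \<ge> 1\<close>
  they span the part of degree \<open>k\<close> of the sum of these ideals.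
\<close>

definition restriction_gens :: "(nat \<Rightarrow> poly3) \<Rightarrow> poly3 \<Rightarrow> nat \<Rightarrow> nat \<Rightarrow> poly3 set" where
  "restriction_gens b a n k =
     (*) a ` S_deg (k - 1) \<union> (\<Union>i<n. (*) (prod b ({..<n} - {i})) ` S_deg (k - (n - 1)))"

lemma exists_third_vector:
  assumes "cross a b \<noteq> 0"
  obtains i where "triple_product a b (coef (var i)) \<noteq> 0"
proof -
  obtain i where "cross a b $ i \<noteq> 0" using assms by (auto simp: vec_eq_iff)
  then have "triple_product a b (coef (var i)) \<noteq> 0"
    using exhaust_3[of i] by (auto simp: triple_product_def dot_def coef_var sum_3)
  then show ?thesis by (rule that)
qed

text \<open>
  Let \<open>I\<^sub>n\<close> be the ideal in question. It satisfies \<open>I\<^bsub>n+1\<^esub> \<supseteq> b\<^sub>n I\<^sub>n + (a)\<close> and also contains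
  \<open>b\<^sub>0 \<cdots> b\<^bsub>n-1\<^esub>\<close>. If the line \<open>b\<^sub>n\<close> meets \<open>a\<close> in a new point, then \<open>a\<close>, \<open>b\<^sub>n\<close> and this product span
  everything in degree \<open>k \<ge> n\<close>, so the codimension does not grow. If the point is old, the power of a
  third variable is one additional vector that suffices. So the codimension is at most the number of
  lines that pass through a point which an earlier line has already contributed.
\<close>

lemma codim_restriction_ideal:
  assumes a: "a \<in> S_deg 1"
    and b: "\<And>i. i < n \<Longrightarrow> b i \<in> S_deg 1" "\<And>i. i < n \<Longrightarrow> cross (coef a) (coef (b i)) \<noteq> 0"
    and n: "1 \<le> n" "n \<le> k"
  shows "\<exists>F. finite F \<and> card F + card ((\<lambda>i. zeros (coef a) \<inter> zeros (coef (b i))) ` {..<n}) \<le> n \<and>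
             S_deg k \<subseteq> P.span (restriction_gens b a n k \<union> F)"
  using n(1) n(2) b
proof (induction n arbitrary: k rule: dec_induct)
  case base
  have "S_deg k \<subseteq> restriction_gens b a 1 k"
    by (auto simp: restriction_gens_def lessThan_Suc)
  then have "S_deg k \<subseteq> P.span (restriction_gens b a 1 k \<union> {})"
    using P.span_superset by fastforce
  then show ?case by (intro exI[of _ "{}"]) (simp add: lessThan_Suc)
next
  case (step n k)
  let ?pt = "\<lambda>i. zeros (coef a) \<inter> zeros (coef (b i))"
  let ?G = "restriction_gens b a n (k - 1)"
  let ?G' = "restriction_gens b a (Suc n) k"
  obtain F where F: "finite F" "card F + card (?pt ` {..<n}) \<le> n" "S_deg (k - 1) \<subseteq> P.span (?G \<union> F)"
  proof -
    have "\<exists>F. finite F \<and> card F + card (?pt ` {..<n}) \<le> n \<and> S_deg (k - 1) \<subseteq> P.span (?G \<union> F)"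
      by (rule step.IH) (use step.prems in auto)
    then show ?thesis using that by blast
  qed
  have k: "Suc n \<le> k" by (rule step.prems)
  have bn: "b n \<in> S_deg 1" "cross (coef a) (coef (b n)) \<noteq> 0" using step.prems by auto
  have lin: "Vector_Spaces.linear scal scal ((*) (b n))"
    by (rule linear_scalI) (simp_all add: ring_distribs)
  have aG': "a * u \<in> P.span ?G'" if "u \<in> S_deg (k - 1)" for u
    by (rule P.span_base) (use that in \<open>auto simp: restriction_gens_def\<close>)
  have bnG: "b n * g \<in> P.span ?G'" if "g \<in> ?G" for g
  proof -
    from that consider u where "u \<in> S_deg (k - 1 - 1)" "g = a * u"
      | i u where "i < n" "u \<in> S_deg (k - 1 - (n - 1))" "g = prod b ({..<n} - {i}) * u"
      unfolding restriction_gens_def by auto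
    then show ?thesis
    proof cases
      case 1
      have "1 + (k - 1 - 1) = k - 1" using k step.hyps(1) by linarith
      then have "b n * u \<in> S_deg (k - 1)" using S_deg_mult[OF bn(1) 1(1)] by simp
      then show ?thesis using aG'[of "b n * u"] 1(2) by (simp add: mult.left_commute)
    next
      case 2
      have "{..<Suc n} - {i} = insert n ({..<n} - {i})" using 2(1) by auto
      then have "b n * g = prod b ({..<Suc n} - {i}) * u" using 2(3) by (simp add: mult.assoc)
      moreover have "u \<in> S_deg (k - (Suc n - 1))" using 2(2) k step.hyps by simp
      ultimately have "b n * g \<in> ?G'" using 2(1) unfolding restriction_gens_def by auto
      then show ?thesis by (rule P.span_base)
    qed
  qed
  have bnF: "b n * v \<in> P.span (?G' \<union> (*) (b n) ` F)" if "v \<in> S_deg (k - 1)" for v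
  proof -
    have "b n * v \<in> P.span ((*) (b n) ` (?G \<union> F))"
      unfolding PP.linear_span_image[OF lin] using that F(3) by (intro imageI) (rule set_mp)
    moreover have "(*) (b n) ` (?G \<union> F) \<subseteq> P.span (?G' \<union> (*) (b n) ` F)"
    proof (intro subsetI, elim imageE UnE)
      fix y g assume "y = b n * g" "g \<in> ?G"
      then have "y \<in> P.span ?G'" using bnG by simp
      then show "y \<in> P.span (?G' \<union> (*) (b n) ` F)"
        by (rule set_mp[OF P.span_mono, rotated]) simp
    next
      fix y g assume "y = b n * g" "g \<in> F"
      then show "y \<in> P.span (?G' \<union> (*) (b n) ` F)"
        by (intro P.span_base UnI2 image_eqI)
    qed
    then have "P.span ((*) (b n) ` (?G \<union> F)) \<subseteq> P.span (?G' \<union> (*) (b n) ` F)"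
      by (rule P.span_minimal) (rule P.subspace_span)
    ultimately show ?thesis by blast
  qed
  have cardF: "card ((*) (b n) ` F) \<le> card F" by (rule card_image_le[OF F(1)])
  have img: "?pt ` {..<Suc n} = insert (?pt n) (?pt ` {..<n})" by (auto simp: lessThan_Suc)
  show ?case
  proof (cases "?pt n \<in> ?pt ` {..<n}")
    case True
    obtain i where "triple_product (coef a) (coef (b n)) (coef (var i)) \<noteq> 0"
      using exists_third_vector[OF bn(2)] by blast
    note c = this
    let ?F = "insert (var i ^ k) ((*) (b n) ` F)"
    have "p \<in> P.span (?G' \<union> ?F)" if p: "p \<in> S_deg k" for p
    proof -
      obtain u v w where uvw: "u \<in> S_deg (k - 1)" "v \<in> S_deg (k - 1)" "w \<in> S_deg 0"
        "p = a * u + b n * v + var i ^ k * w"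
        using S_deg_decompose_prod[OF a bn(1), of k "\<lambda>_. var i" p 0] p c var_in_S_deg by auto
      obtain z where "w = const z" using S_deg_0E uvw(3) by blast
      then have "p = a * u + b n * v + scal z (var i ^ k)" using uvw(4) by (simp add: scal_def mult.commute)
      moreover have "a * u \<in> P.span (?G' \<union> ?F)"
        using aG'[OF uvw(1)] P.span_mono[of ?G' "?G' \<union> ?F"] by blast
      moreover have "b n * v \<in> P.span (?G' \<union> ?F)"
        using bnF[OF uvw(2)] P.span_mono[of "?G' \<union> (*) (b n) ` F" "?G' \<union> ?F"] by blast
      moreover have "scal z (var i ^ k) \<in> P.span (?G' \<union> ?F)"
        by (intro P.span_scale P.span_base) auto
      ultimately show ?thesis by (auto intro: P.span_add)
    qed
    moreover have "card ?F + card (?pt ` {..<Suc n}) \<le> Suc n"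
      using cardF F(1,2) True card_insert_le_m1[of "Suc (card F)" "(*) (b n) ` F" "var i ^ k"]
      unfolding img by (simp add: insert_absorb card_insert_if)
    ultimately show ?thesis using F(1) by (intro exI[of _ ?F]) auto
  next
    case False
    have c: "triple_product (coef a) (coef (b n)) (coef (b j)) \<noteq> 0" if "j < n" for j
    proof -
      have "cross (coef a) (coef (b j)) \<noteq> 0" using step.prems that by simp
      then have "triple_product (coef a) (coef (b n)) (coef (b j)) = 0 \<longleftrightarrow> ?pt n = ?pt j"
        using zeros_Int_eq_iff[OF bn(2)] by blast
      then show ?thesis using False that by blast
    qed
    let ?F = "(*) (b n) ` F"
    have "p \<in> P.span (?G' \<union> ?F)" if p: "p \<in> S_deg k" for p
    proof -
      have "\<exists>u v w. u \<in> S_deg (k - n + n - 1) \<and> v \<in> S_deg (k - n + n - 1) \<and> w \<in> S_deg (k - n) \<and>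
           p = a * u + b n * v + (\<Prod>j<n. b j) * w"
        by (rule S_deg_decompose_prod[OF a bn(1)]) (use c p k step.prems in auto)
      then obtain u v w where uvw: "u \<in> S_deg (k - 1)" "v \<in> S_deg (k - 1)" "w \<in> S_deg (k - n)"
        "p = a * u + b n * v + (\<Prod>j<n. b j) * w"
        using k by auto
      have "(\<Prod>j<n. b j) * w \<in> ?G'"
      proof -
        have "{..<n} = {..<Suc n} - {n}" by auto
        then have "(\<Prod>j<n. b j) * w = prod b ({..<Suc n} - {n}) * w" by simp
        moreover have "w \<in> S_deg (k - (Suc n - 1))" using uvw(3) by simp
        ultimately have "(\<Prod>j<n. b j) * w \<in> (*) (prod b ({..<Suc n} - {n})) ` S_deg (k - (Suc n - 1))"
          by (rule image_eqI)
        then show ?thesis unfolding restriction_gens_def by blast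
      qed
      then have "(\<Prod>j<n. b j) * w \<in> P.span (?G' \<union> ?F)" by (intro P.span_base) auto
      moreover have "a * u \<in> P.span (?G' \<union> ?F)"
        using aG'[OF uvw(1)] P.span_mono[of ?G' "?G' \<union> ?F"] by blast
      ultimately show ?thesis using bnF[OF uvw(2)] uvw(4) by (auto intro: P.span_add)
    qed
    moreover have "card ?F + card (?pt ` {..<Suc n}) \<le> Suc n"
      using cardF F(2) False unfolding img by simp
    ultimately show ?thesis using F(1) by (intro exI[of _ ?F]) auto
  qed
qed

text \<open>
  A nonzero cross product means that the two coefficient vectors are not proportional, i.e. that the
  lines are distinct.
\<close>

locale line_arrangement =
  fixes d :: nat and \<alpha> :: "nat \<Rightarrow> poly3"
  assumes two_lines: "2 \<le> d"
    and linear: "i < d \<Longrightarrow> \<alpha> i \<in> S_deg 1"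
    and distinct: "i < d \<Longrightarrow> j < d \<Longrightarrow> i \<noteq> j \<Longrightarrow> cross (coef (\<alpha> i)) (coef (\<alpha> j)) \<noteq> 0"
begin

definition equation :: poly3 where
  "equation = prod \<alpha> {..<d}"

text \<open>
  The degree is \<open>k + 1\<close>, so that the quotients \<open>\<theta>(\<alpha>\<^sub>j)/\<alpha>\<^sub>j\<close> have degree \<open>k\<close>.
\<close>

definition tangent :: "nat \<Rightarrow> nat \<Rightarrow> (poly3 ^ 3) set" where
  "tangent k n = {\<theta> \<in> VS_deg (Suc k). \<forall>j<n. apply_field \<theta> (\<alpha> j) \<in> (*) (\<alpha> j) ` S_deg k}"

lemma nonzero: "i < d \<Longrightarrow> \<alpha> i \<noteq> 0"
proof
  assume i: "i < d" "\<alpha> i = 0"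
  obtain j where "j < d" "j \<noteq> i" using two_lines that[of 0] that[of 1] by (cases "i = 0") auto
  then have "cross (coef (\<alpha> i)) (coef (\<alpha> j)) \<noteq> 0" using distinct i by metis
  then show False using i(2) by (simp add: coef_def vec3_simps)
qed

lemma equation_nonzero: "equation \<noteq> 0"
  using nonzero by (auto simp: equation_def)

lemma equation_deg: "equation \<in> S_deg d"
  using S_deg_prod[of "{..<d}" \<alpha>] linear by (simp add: equation_def)

lemma apply_field_alpha_deg: "\<theta> \<in> VS_deg k \<Longrightarrow> i < d \<Longrightarrow> apply_field \<theta> (\<alpha> i) \<in> S_deg k"
  by (rule apply_field_in_S_deg[OF _ linear]) (auto simp: VS_deg_def)

lemma subspace_tangent: "n \<le> d \<Longrightarrow> V.subspace (tangent k n)"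
proof (induction n)
  case 0
  then show ?case by (simp add: tangent_def subspace_VS_deg)
next
  case (Suc n)
  have "tangent k (Suc n) = tangent k n \<inter> (\<lambda>\<theta>. apply_field \<theta> (\<alpha> n)) -` ((*) (\<alpha> n) ` S_deg k)"
    by (auto simp: tangent_def less_Suc_eq)
  moreover have "P.subspace ((*) (\<alpha> n) ` S_deg k)"
    using Suc.prems by (intro multiples_of_S_deg(2) nonzero) simp
  ultimately show ?case
    using V.subspace_inter[OF _ VP.linear_subspace_vimage[OF linear_app, of _ "\<alpha> n"]] Suc
    by simp
qed

lemma fin_spanned_tangent: "V.fin_spanned (tangent k n)"
  by (rule V.fin_spanned_subset[OF fin_spanned_VS_deg]) (auto simp: tangent_def)

text \<open>
  Its codimension in \<open>S\<^bsub>k+1\<^esub>\<close> is the number of redundant conditions among those that the tangency to the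
  line \<open>n\<close> imposes on the fields tangent to the previous lines.
\<close>

definition tangency_values :: "nat \<Rightarrow> nat \<Rightarrow> poly3 set" where
  "tangency_values k n = {y + m |y m. y \<in> (\<lambda>\<theta>. apply_field \<theta> (\<alpha> n)) ` tangent k n \<and> m \<in> (*) (\<alpha> n) ` S_deg k}"

lemma dim_tangent_Suc:
  assumes "n < d"
  shows "V.dim (tangent k (Suc n)) + P.dim (tangency_values k n) = V.dim (tangent k n) + P.dim (S_deg k)"
proof -
  have "{\<theta> \<in> tangent k n. apply_field \<theta> (\<alpha> n) \<in> (*) (\<alpha> n) ` S_deg k} = tangent k (Suc n)"
    by (auto simp: tangent_def less_Suc_eq)
  then show ?thesis
    using VP.dim_preimage[OF linear_app[of "\<alpha> n"] subspace_tangent fin_spanned_tangent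
        multiples_of_S_deg(2,3)[OF nonzero[OF assms]], of n k k] multiples_of_S_deg(1)[OF nonzero[OF assms], of k] assms
    unfolding tangency_values_def by simp
qed

lemma tangency_values_subset: "n < d \<Longrightarrow> tangency_values k n \<subseteq> S_deg (Suc k)"
  unfolding tangency_values_def using apply_field_alpha_deg[of _ "Suc k" n] S_deg_mult[OF linear, of n _ k]
  by (auto simp: tangent_def intro!: S_deg_add)

text \<open>
  If \<open>v\<close> is a constant field with \<open>v(\<alpha>\<^sub>n) = 1\<close>, then \<open>u (\<Prod>\<^bsub>j\<in>J\<^esub> \<alpha>\<^sub>j) v\<close> is tangent to the lines in \<open>J\<close> whatever \<open>v\<close> is,
  and to the other ones if \<open>v\<close> kills them. For \<open>n > 0\<close>, the set \<open>J\<close> omits a single line \<open>i\<close>, and \<open>v\<close>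
  has to kill \<open>\<alpha>\<^sub>i\<close>; this yields the generators of \<open>codim_restriction_ideal\<close>. For \<open>n = 0\<close> there are no
  conditions, and the values are all of \<open>S\<^bsub>k+1\<^esub>\<close>.
\<close>

lemma tangency_values_large:
  assumes n: "n < d" and k: "d \<le> k"
  shows "\<exists>F. finite F \<and> card F + card ((\<lambda>i. zeros (coef (\<alpha> n)) \<inter> zeros (coef (\<alpha> i))) ` {..<n}) \<le> n \<and>
             S_deg (Suc k) \<subseteq> P.span (tangency_values k n \<union> F)"
proof -
  have field: "prod \<alpha> J * u \<in> (\<lambda>\<theta>. apply_field \<theta> (\<alpha> n)) ` tangent k n"
    if v: "\<And>i. v $ i \<in> S_deg 0" "apply_field v (\<alpha> n) = 1" and J: "J \<subseteq> {..<n}"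
      "\<And>j. j < n \<Longrightarrow> j \<notin> J \<Longrightarrow> apply_field v (\<alpha> j) = 0" and u: "u \<in> S_deg (Suc k - card J)" for v J u
  proof -
    let ?\<theta> = "\<chi> i. (prod \<alpha> J * u) * v $ i"
    have cJ: "card J \<le> n" "finite J" using J(1) card_mono[of "{..<n}" J] finite_subset[of J "{..<n}"] by simp_all
    have J_deg: "prod \<alpha> I \<in> S_deg (card I)" if "I \<subseteq> J" for I
      using that J(1) n linear by (intro S_deg_prod) auto
    have "prod \<alpha> J * u \<in> S_deg (Suc k)"
      using S_deg_mult[OF J_deg[of J] u] cJ n k by simp
    then have "?\<theta> \<in> VS_deg (Suc k)"
      using S_deg_mult[OF _ v(1), of "prod \<alpha> J * u" "Suc k"] by (auto simp: VS_deg_def)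
    moreover have "apply_field ?\<theta> (\<alpha> j) \<in> (*) (\<alpha> j) ` S_deg k" if "j < n" for j
    proof (cases "j \<in> J")
      case True
      have "apply_field v (\<alpha> j) \<in> S_deg 0" using apply_field_in_S_deg[of v 0 "\<alpha> j"] v(1) linear that n by simp
      moreover have "prod \<alpha> (J - {j}) * u \<in> S_deg k"
      proof -
        have "card (J - {j}) = card J - 1" "card J \<noteq> 0"
          using True cJ by auto
        then have "card (J - {j}) + (Suc k - card J) = k" using cJ n k by linarith
        then show ?thesis using S_deg_mult[OF J_deg[of "J - {j}"] u] by simp
      qed
      ultimately have "prod \<alpha> (J - {j}) * u * apply_field v (\<alpha> j) \<in> S_deg k" using S_deg_mult by fastforce
      moreover have "apply_field ?\<theta> (\<alpha> j) = \<alpha> j * (prod \<alpha> (J - {j}) * u * apply_field v (\<alpha> j))"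
        unfolding apply_field_vscal using prod.remove[OF cJ(2) True, of \<alpha>] by (simp add: mult_ac)
      ultimately show ?thesis by blast
    next
      case False
      then have "apply_field ?\<theta> (\<alpha> j) = \<alpha> j * 0" using J(2)[OF that] by (simp add: apply_field_vscal)
      then show ?thesis using S_deg_zero by blast
    qed
    ultimately have "?\<theta> \<in> tangent k n" by (simp add: tangent_def)
    moreover have "apply_field ?\<theta> (\<alpha> n) = prod \<alpha> J * u" by (simp add: apply_field_vscal v(2))
    ultimately show ?thesis by (metis imageI)
  qed
  have sub: "(\<lambda>\<theta>. apply_field \<theta> (\<alpha> n)) ` tangent k n \<subseteq> tangency_values k n"
  proof
    fix y assume "y \<in> (\<lambda>\<theta>. apply_field \<theta> (\<alpha> n)) ` tangent k n"
    moreover have "y = y + \<alpha> n * 0" by simp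
    ultimately show "y \<in> tangency_values k n" unfolding tangency_values_def using S_deg_zero by blast
  qed
  show ?thesis
  proof (cases "n = 0")
    case True
    \<comment> \<open>The second line only serves to find a constant field that does not kill the first form.\<close>
    have "cross (coef (\<alpha> 1)) (coef (\<alpha> n)) \<noteq> 0" using True distinct two_lines by simp
    then obtain v where v: "\<And>i. v $ i \<in> S_deg 0" "apply_field v (\<alpha> 1) = 0" "apply_field v (\<alpha> n) = 1"
      using exists_constant_field[OF linear linear, of 1 n] n two_lines by (metis One_nat_def Suc_1 Suc_le_lessD)
    have "S_deg (Suc k) \<subseteq> tangency_values k n"
      using field[of v "{}", OF v(1,3)] True sub by auto
    then have "S_deg (Suc k) \<subseteq> P.span (tangency_values k n \<union> {})"
      using P.span_superset[of "tangency_values k n"] by auto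
    then show ?thesis using True by (intro exI[of _ "{}"]) simp
  next
    case False
    obtain F where F: "finite F" "card F + card ((\<lambda>i. zeros (coef (\<alpha> n)) \<inter> zeros (coef (\<alpha> i))) ` {..<n}) \<le> n"
      "S_deg (Suc k) \<subseteq> P.span (restriction_gens \<alpha> (\<alpha> n) n (Suc k) \<union> F)"
proof -
      have "\<exists>F. finite F \<and> card F + card ((\<lambda>i. zeros (coef (\<alpha> n)) \<inter> zeros (coef (\<alpha> i))) ` {..<n}) \<le> n \<and>
          S_deg (Suc k) \<subseteq> P.span (restriction_gens \<alpha> (\<alpha> n) n (Suc k) \<union> F)"
        by (rule codim_restriction_ideal) (use False n k linear distinct in auto)
      then show ?thesis using that by blast
    qed
    have "restriction_gens \<alpha> (\<alpha> n) n (Suc k) \<subseteq> tangency_values k n"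
    proof
      fix g assume "g \<in> restriction_gens \<alpha> (\<alpha> n) n (Suc k)"
      then consider u where "u \<in> S_deg k" "g = \<alpha> n * u"
        | i u where "i < n" "u \<in> S_deg (Suc k - (n - 1))" "g = prod \<alpha> ({..<n} - {i}) * u"
        unfolding restriction_gens_def by auto
      then show "g \<in> tangency_values k n"
      proof cases
        case 1
        have "(\<lambda>\<theta>. apply_field \<theta> (\<alpha> n)) 0 \<in> (\<lambda>\<theta>. apply_field \<theta> (\<alpha> n)) ` tangent k n"
          using V.subspace_0[OF subspace_tangent] n by (intro imageI) simp
        then have "0 \<in> (\<lambda>\<theta>. apply_field \<theta> (\<alpha> n)) ` tangent k n" by (simp add: apply_field_def)
        moreover have "g = 0 + \<alpha> n * u" using 1 by simp
        ultimately show ?thesis unfolding tangency_values_def using 1(1) by blast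
      next
        case 2
        have "cross (coef (\<alpha> i)) (coef (\<alpha> n)) \<noteq> 0" using 2(1) n distinct by simp
        then obtain v where v: "\<And>i. v $ i \<in> S_deg 0" "apply_field v (\<alpha> i) = 0" "apply_field v (\<alpha> n) = 1"
          using exists_constant_field[OF linear linear, of i n] n 2(1) by (metis less_trans)
        have "g \<in> (\<lambda>\<theta>. apply_field \<theta> (\<alpha> n)) ` tangent k n"
          unfolding 2(3) by (rule field[OF v(1,3)]) (use 2 v(2) in auto)
        then show ?thesis using sub by blast
      qed
    qed
    then have "P.span (restriction_gens \<alpha> (\<alpha> n) n (Suc k) \<union> F) \<subseteq> P.span (tangency_values k n \<union> F)"
      by (intro P.span_mono) blast
    then show ?thesis using F by blast
  qed
qed

end

section \<open>Exponents of a free arrangement\<close>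

context line_arrangement begin

definition points_on :: "nat \<Rightarrow> (complex ^ 3) set set" where
  "points_on n = (\<lambda>i. zeros (coef (\<alpha> n)) \<inter> zeros (coef (\<alpha> i))) ` {..<n}"

text \<open>
  At most \<open>n - r\<^sub>n\<close> of the \<open>k + 2\<close> conditions that line \<open>n\<close> imposes are redundant, where \<open>r\<^sub>n\<close> is
  the number of its points on earlier lines.
\<close>

lemma dim_tangent_upper:
  assumes "n \<le> d" "d \<le> k"
  shows "V.dim (tangent k n) + n * P.dim (S_deg (Suc k)) + (\<Sum>m<n. card (points_on m))
           \<le> 3 * P.dim (S_deg (Suc k)) + n * P.dim (S_deg k) + (\<Sum>m<n. m)"
  using assms(1)
proof (induction n)
  case 0
  have "V.dim (tangent k 0) = 3 * P.dim (S_deg (Suc k))"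
    using dim_VS_deg[of "Suc k"] by (simp add: tangent_def)
  then show ?case by simp
next
  case (Suc n)
  have n: "n < d" using Suc.prems by simp
  obtain F where F: "finite F" "card F + card (points_on n) \<le> n"
    "S_deg (Suc k) \<subseteq> P.span (tangency_values k n \<union> F)"
    using tangency_values_large[OF n assms(2)] unfolding points_on_def by blast
  have "P.fin_spanned (tangency_values k n)"
    by (rule P.fin_spanned_subset[OF fin_spanned_S_deg tangency_values_subset[OF n]])
  then have "P.dim (S_deg (Suc k)) \<le> P.dim (tangency_values k n) + card F"
    by (rule P.dim_le_add_card[OF F(3) _ F(1)])
  then show ?case using dim_tangent_Suc[OF n, of k] Suc F(2) by simp
qed

lemma dim_tangent_lower:
  assumes "n \<le> d"
  shows "3 * P.dim (S_deg (Suc k)) + n * P.dim (S_deg k) \<le> V.dim (tangent k n) + n * P.dim (S_deg (Suc k))"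
  using assms
proof (induction n)
  case 0
  have "V.dim (tangent k 0) = 3 * P.dim (S_deg (Suc k))"
    using dim_VS_deg[of "Suc k"] by (simp add: tangent_def)
  then show ?case by simp
next
  case (Suc n)
  have n: "n < d" using Suc.prems by simp
  have "P.dim (tangency_values k n) \<le> P.dim (S_deg (Suc k))"
    by (rule P.dim_mono_fin_spanned[OF fin_spanned_S_deg tangency_values_subset[OF n]])
  then show ?case using dim_tangent_Suc[OF n, of k] Suc by simp
qed

lemma AR_iff: "\<theta> \<in> AR f \<longleftrightarrow> apply_field \<theta> f = 0"
  by (simp add: AR_def apply_field_def sum_3)

text \<open>
  All but one of the terms of \<open>0 = \<theta>(f) = \<Sum>\<^sub>i \<theta>(\<alpha>\<^sub>i) f/\<alpha>\<^sub>i\<close> are divisible by a given \<open>\<alpha>\<^sub>i\<close>, hence so is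
  \<open>\<theta>(\<alpha>\<^sub>i) f/\<alpha>\<^sub>i\<close>; and \<open>\<alpha>\<^sub>i\<close> is prime to the other forms.
\<close>

lemma AR_subset_tangent: "AR equation \<inter> VS_deg (Suc k) \<subseteq> tangent k d"
proof
  fix \<theta> assume \<theta>: "\<theta> \<in> AR equation \<inter> VS_deg (Suc k)"
  have "apply_field \<theta> (\<alpha> i) \<in> (*) (\<alpha> i) ` S_deg k" if i: "i < d" for i
  proof -
    let ?I = "{..<d}"
    let ?c = "- (\<Sum>j\<in>?I - {i}. apply_field \<theta> (\<alpha> j) * prod \<alpha> (?I - {j} - {i}))"
    have "0 = apply_field \<theta> (prod \<alpha> ?I)"
      using \<theta> by (simp add: AR_iff equation_def)
    also have "\<dots> = apply_field \<theta> (\<alpha> i) * prod \<alpha> (?I - {i}) + (\<Sum>j\<in>?I - {i}. apply_field \<theta> (\<alpha> j) * prod \<alpha> (?I - {j}))"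
      unfolding apply_field_prod[OF finite_lessThan] using i by (intro sum.remove) auto
    also have "(\<Sum>j\<in>?I - {i}. apply_field \<theta> (\<alpha> j) * prod \<alpha> (?I - {j})) = - (\<alpha> i * ?c)"
    proof -
      have "prod \<alpha> (?I - {j}) = \<alpha> i * prod \<alpha> (?I - {j} - {i})" if "j \<in> ?I - {i}" for j
        using that i by (intro prod.remove) auto
      then show ?thesis by (simp add: sum_distrib_left mult_ac)
    qed
    finally have eq: "prod \<alpha> (?I - {i}) * apply_field \<theta> (\<alpha> i) = \<alpha> i * ?c"
      by (simp add: algebra_simps eq_neg_iff_add_eq_0)
    have "?c \<in> S_deg (Suc k + (d - 2))"
    proof (intro S_deg_uminus S_deg_sum S_deg_mult)
      fix j assume j: "j \<in> ?I - {i}"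
      show "apply_field \<theta> (\<alpha> j) \<in> S_deg (Suc k)" using \<theta> j by (intro apply_field_alpha_deg) auto
      have "card (?I - {j} - {i}) = d - 2" using j i by (simp add: card_Diff_singleton)
      then show "prod \<alpha> (?I - {j} - {i}) \<in> S_deg (d - 2)"
        using S_deg_prod[of "?I - {j} - {i}" \<alpha>] linear by auto
    qed
    moreover have "card (?I - {i}) + Suc k = Suc (Suc k + (d - 2))" using i two_lines by simp
    ultimately have c: "?c \<in> S_shift 1 (card (?I - {i}) + Suc k)" by (simp add: S_shift_def add_ac)
    have "apply_field \<theta> (\<alpha> i) \<in> (*) (\<alpha> i) ` S_shift 1 (Suc k)"
      by (rule linear_form_divides_prod[OF _ linear[OF i] _ _ eq _ c])
        (use i \<theta> linear distinct apply_field_alpha_deg in auto)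
    then show ?thesis by (simp add: S_shift_def)
  qed
  then show "\<theta> \<in> tangent k d" using \<theta> by (simp add: tangent_def)
qed

text \<open>
  A tangent field maps \<open>f\<close> to \<open>f \<Sum>\<^sub>i \<theta>(\<alpha>\<^sub>i)/\<alpha>\<^sub>i\<close>, and multiples of the Euler field produce all multiples
  of \<open>f\<close>, since the Euler field maps \<open>f\<close> to \<open>d f\<close>.
\<close>

lemma image_tangent_equation: "(\<lambda>\<theta>. apply_field \<theta> equation) ` tangent k d = (*) equation ` S_deg k"
proof (intro equalityI subsetI)
  fix p assume "p \<in> (\<lambda>\<theta>. apply_field \<theta> equation) ` tangent k d"
  then obtain \<theta> where \<theta>: "\<theta> \<in> tangent k d" "p = apply_field \<theta> equation" by blast
  then have "\<forall>i\<in>{..<d}. \<exists>g. g \<in> S_deg k \<and> apply_field \<theta> (\<alpha> i) = \<alpha> i * g"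
    by (auto simp: tangent_def)
  then obtain g where g: "\<And>i. i < d \<Longrightarrow> g i \<in> S_deg k" "\<And>i. i < d \<Longrightarrow> apply_field \<theta> (\<alpha> i) = \<alpha> i * g i"
    by (metis lessThan_iff)
  have "p = (\<Sum>i<d. apply_field \<theta> (\<alpha> i) * prod \<alpha> ({..<d} - {i}))"
    by (simp add: \<theta>(2) equation_def apply_field_prod)
  also have "\<dots> = (\<Sum>i<d. equation * g i)"
  proof (rule sum.cong[OF refl])
    fix i assume i: "i \<in> {..<d}"
    have "equation = \<alpha> i * prod \<alpha> ({..<d} - {i})"
      unfolding equation_def using i by (intro prod.remove) auto
    then show "apply_field \<theta> (\<alpha> i) * prod \<alpha> ({..<d} - {i}) = equation * g i" using g(2) i by (simp add: mult_ac)
  qed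
  also have "\<dots> = equation * (\<Sum>i<d. g i)" by (simp add: sum_distrib_left)
  finally show "p \<in> (*) equation ` S_deg k"
    by (rule image_eqI) (use g(1) in \<open>auto intro: S_deg_sum\<close>)
next
  fix p assume "p \<in> (*) equation ` S_deg k"
  then obtain u where u: "u \<in> S_deg k" "p = equation * u" by blast
  let ?u = "const (1 / of_nat d) * u"
  let ?\<theta> = "\<chi> i. ?u * (\<chi> i. var i) $ i"
  have apply_field: "apply_field ?\<theta> q = of_nat m * (?u * q)" if "q \<in> S_deg m" for q m
    using Euler_identity[OF that] unfolding apply_field_vscal by (simp add: apply_field_def algebra_simps)
  have uk: "?u \<in> S_deg k" by (rule const_mult_in_S_deg[OF u(1)])
  have "?\<theta> \<in> VS_deg (Suc k)"
    using S_deg_mult[OF uk var_in_S_deg] by (simp add: VS_deg_def)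
  moreover have "apply_field ?\<theta> (\<alpha> j) = \<alpha> j * ?u" if "j < d" for j
    using apply_field[OF linear[OF that]] by (simp add: mult_ac)
  then have "\<forall>j<d. apply_field ?\<theta> (\<alpha> j) \<in> (*) (\<alpha> j) ` S_deg k" using uk by blast
  ultimately have "?\<theta> \<in> tangent k d" by (simp add: tangent_def)
  moreover have "apply_field ?\<theta> equation = p"
  proof -
    have "apply_field ?\<theta> equation = const (of_nat d) * const (1 / of_nat d) * (equation * u)"
      unfolding apply_field[OF equation_deg] const_of_nat by (simp add: mult_ac)
    also have "\<dots> = p" using two_lines by (simp add: u(2) flip: const_mult)
    finally show ?thesis .
  qed
  ultimately show "p \<in> (\<lambda>\<theta>. apply_field \<theta> equation) ` tangent k d" by blast
qed

lemma dim_tangent_eq_AR: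
  "V.dim (tangent k d) = V.dim (AR equation \<inter> VS_deg (Suc k)) + P.dim (S_deg k)"
proof -
  have "{\<theta> \<in> tangent k d. apply_field \<theta> equation = 0} = AR equation \<inter> VS_deg (Suc k)"
    using AR_subset_tangent[of k] by (auto simp: AR_iff tangent_def)
  then show ?thesis
    using VP.rank_nullity_on_subspace[OF linear_app[of equation] subspace_tangent[OF order_refl, of k] fin_spanned_tangent]
    by (simp add: image_tangent_equation multiples_of_S_deg(1)[OF equation_nonzero])
qed

end

lemma linear_bounded_imp_slope_nonpos:
  fixes A B :: real
  assumes "\<And>k. k0 \<le> k \<Longrightarrow> A * real k + B \<le> 0"
  shows "A \<le> 0"
proof (rule ccontr)
  assume "\<not> A \<le> 0"
  then have A: "A > 0" by simp
  obtain n :: nat where "- B / A < real n" using reals_Archimedean2 by blast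
  then have "- B / A < real (max k0 n)" by simp
  then have "0 < A * real (max k0 n) + B" using A by (simp add: field_simps)
  then show False using assms[of "max k0 n"] by simp
qed

context line_arrangement begin

text \<open>
  With \<open>k\<close> as the variable, \<open>A k + B\<close> is twice the difference between the trivial lower bound for the
  dimension of the tangent fields of degree \<open>k\<close> and the dimension that the exponents give. It is
  bounded from above and from below for all large \<open>k\<close>, so its slope \<open>A\<close> vanishes. This determines
  \<open>d\<^sub>1 + d\<^sub>2\<close>, and then \<open>B\<close> gives the inequality.
\<close>

lemma free_exponents:
  assumes iso: "AR_graded_iso d1 d2 equation \<phi>"
  shows "d1 + d2 + 1 = d" and "(\<Sum>n<d. card (points_on n)) \<le> d1 * d2 + d1 + d2"
proof -
  define b where "b = (\<Sum>n<d. card (points_on n))"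
  define A B where "A = 2 + 2 * (real d1 + real d2) - 2 * real d"
    and "B = 2 + 3 * (real d1 + real d2) - (real d1)\<^sup>2 - (real d2)\<^sup>2 - 2 * real d"
  have dim: "2 * real (P.dim (S_deg n)) = (real n + 1) * (real n + 2)" for n
    using arg_cong[OF two_dim_S_deg[of n], of real] by (simp only: of_nat_mult of_nat_add of_nat_1 of_nat_numeral)
  have gauss: "2 * real (\<Sum>m<n. m) = real n * (real n - 1)" for n
    by (induction n) (simp_all add: algebra_simps)
  have bounds: "A * real k + B \<le> 0 \<and> 2 * real b - real d * (real d - 1) \<le> A * real k + B"
    if k: "d + d1 + d2 + 1 \<le> k" for k
  proof -
    obtain l where l: "k = Suc l" using k by (cases k) auto
    have e: "V.dim (tangent l d) = P.dim (S_deg (k - d1)) + P.dim (S_deg (k - d2)) + P.dim (S_deg l)"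
      using dim_tangent_eq_AR[of l] dim_AR_if_graded_iso[OF iso, of k] k l by simp
    have lower: "3 * P.dim (S_deg k) + d * P.dim (S_deg l) \<le> V.dim (tangent l d) + d * P.dim (S_deg k)"
      using dim_tangent_lower[of d l] l by simp
    have upper: "V.dim (tangent l d) + d * P.dim (S_deg k) + b
        \<le> 3 * P.dim (S_deg k) + d * P.dim (S_deg l) + (\<Sum>m<d. m)"
      using dim_tangent_upper[of d l] k l by (simp add: b_def)
    have dims: "2 * real (P.dim (S_deg l)) = real k * (real k + 1)"
      "2 * real (P.dim (S_deg k)) = (real k + 1) * (real k + 2)"
      "2 * real (P.dim (S_deg (k - d1))) = (real k - real d1 + 1) * (real k - real d1 + 2)"
      "2 * real (P.dim (S_deg (k - d2))) = (real k - real d2 + 1) * (real k - real d2 + 2)"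
    proof -
      have "real l = real k - 1" "real (k - d1) = real k - real d1" "real (k - d2) = real k - real d2"
        using k l by (simp_all add: of_nat_diff)
      then show "2 * real (P.dim (S_deg l)) = real k * (real k + 1)"
        "2 * real (P.dim (S_deg k)) = (real k + 1) * (real k + 2)"
        "2 * real (P.dim (S_deg (k - d1))) = (real k - real d1 + 1) * (real k - real d1 + 2)"
        "2 * real (P.dim (S_deg (k - d2))) = (real k - real d2 + 1) * (real k - real d2 + 2)"
        unfolding dim by (simp_all only:) simp
    qed
    have dims': "real d * (2 * real (P.dim (S_deg k))) - real d * (2 * real (P.dim (S_deg l))) = 2 * real d * (real k + 1)"
      unfolding dims by (simp add: algebra_simps)
    have lower': "3 * real (P.dim (S_deg k)) + real d * real (P.dim (S_deg l))
        \<le> real (P.dim (S_deg (k - d1))) + real (P.dim (S_deg (k - d2))) + real (P.dim (S_deg l)) + real d * real (P.dim (S_deg k))"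
      using of_nat_mono[where ?'a = real, OF lower[unfolded e]] by (simp only: of_nat_add of_nat_mult of_nat_numeral)
    have upper': "real (P.dim (S_deg (k - d1))) + real (P.dim (S_deg (k - d2))) + real (P.dim (S_deg l)) + real d * real (P.dim (S_deg k)) + real b
        \<le> 3 * real (P.dim (S_deg k)) + real d * real (P.dim (S_deg l)) + real (\<Sum>m<d. m)"
      using of_nat_mono[where ?'a = real, OF upper[unfolded e]] by (simp only: of_nat_add of_nat_mult of_nat_numeral)
    have AB: "A * real k + B = 3 * ((real k + 1) * (real k + 2)) - real k * (real k + 1)
        - (real k - real d1 + 1) * (real k - real d1 + 2) - (real k - real d2 + 1) * (real k - real d2 + 2)
        - 2 * real d * (real k + 1)"
      by (simp add: A_def B_def algebra_simps power2_eq_square)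
    show ?thesis
      unfolding AB dims[symmetric] dims'[symmetric] gauss[symmetric] using lower' upper' by linarith
  qed
  have "A \<le> 0" using linear_bounded_imp_slope_nonpos[of "d + d1 + d2 + 1" A B] bounds by blast
  moreover have "- A \<le> 0"
    using linear_bounded_imp_slope_nonpos[of "d + d1 + d2 + 1" "- A" "2 * real b - real d * (real d - 1) - B"] bounds
    by (smt (verit) mult_minus_left)
  ultimately have A: "A = 0" by simp
  then have "real (d1 + d2 + 1) = real d" by (simp add: A_def)
  then show e: "d1 + d2 + 1 = d" by (simp only: of_nat_eq_iff)
  have "2 * real b \<le> real d * (real d - 1) + B" using bounds[OF order_refl] A by simp
  also have "\<dots> = 2 * real (d1 * d2 + d1 + d2)"
    by (simp add: B_def power2_eq_square algebra_simps flip: e)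
  finally have "real b \<le> real (d1 * d2 + d1 + d2)" by (simp only: mult_le_cancel_left_pos[OF zero_less_numeral])
  then show "(\<Sum>n<d. card (points_on n)) \<le> d1 * d2 + d1 + d2" unfolding b_def by (simp only: of_nat_le_iff)
qed

end

section \<open>Points and lines of an arrangement\<close>

text \<open>
  The combinatorial part is about a family of pairwise incomparable proper subsets, the
  lines, whose pairwise intersections, the points, satisfy the following: a point lying on two
  different lines is their intersection.
\<close>

locale incidence =
  fixes d :: nat and H :: "nat \<Rightarrow> 'a set"
  assumes proper: "i < d \<Longrightarrow> H i \<noteq> UNIV"
    and incomparable: "i < d \<Longrightarrow> j < d \<Longrightarrow> H i \<subseteq> H j \<Longrightarrow> i = j"
    and meet: "i < d \<Longrightarrow> j < d \<Longrightarrow> i \<noteq> j \<Longrightarrow> l < d \<Longrightarrow> m < d \<Longrightarrow> l \<noteq> m \<Longrightarrow>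
      H i \<inter> H j \<subseteq> H l \<Longrightarrow> H i \<inter> H j \<subseteq> H m \<Longrightarrow> H i \<inter> H j = H l \<inter> H m"
begin

definition points :: "'a set set" where
  "points = {H i \<inter> H j |i j. i < d \<and> j < d \<and> i \<noteq> j}"

definition lines_through :: "'a set \<Rightarrow> nat set" where
  "lines_through p = {i. i < d \<and> p \<subseteq> H i}"

lemma finite_points: "finite points"
proof -
  have "points \<subseteq> (\<lambda>(i, j). H i \<inter> H j) ` ({..<d} \<times> {..<d})"
    by (auto simp: points_def)
  then show ?thesis by (rule finite_subset) simp
qed

lemma finite_lines_through: "finite (lines_through p)"
  by (simp add: lines_through_def)

lemma point_eq_meet:
  assumes "p \<in> points" "i \<in> lines_through p" "j \<in> lines_through p" "i \<noteq> j"
  shows "p = H i \<inter> H j"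
proof -
  obtain a b where "p = H a \<inter> H b" "a < d" "b < d" "a \<noteq> b"
    using assms(1) unfolding points_def by blast
  then show ?thesis using meet[of a b i j] assms(2-4) unfolding lines_through_def by blast
qed

lemma lines_through_nonempty: "p \<in> points \<Longrightarrow> lines_through p \<noteq> {}"
  by (auto simp: points_def lines_through_def)

text \<open>
  Each ordered pair of distinct lines has exactly one intersection point.
\<close>

lemma sum_pairs: "(\<Sum>p\<in>points. card (lines_through p) * (card (lines_through p) - 1)) = d * (d - 1)"
proof -
  have pairs: "card (SIGMA i:A. A - {i}) = card A * (card A - 1)" if "finite A" for A :: "nat set"
    using that by (simp add: card_Diff_singleton)
  have "(SIGMA i:{..<d}. {..<d} - {i}) = (\<Union>p\<in>points. SIGMA i:lines_through p. lines_through p - {i})"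
    by (auto simp: points_def lines_through_def)
  then have "d * (d - 1) = card (\<Union>p\<in>points. SIGMA i:lines_through p. lines_through p - {i})"
    using pairs[of "{..<d}"] by simp
  also have "\<dots> = (\<Sum>p\<in>points. card (SIGMA i:lines_through p. lines_through p - {i}))"
  proof (rule card_UN_disjoint)
    show "\<forall>p\<in>points. \<forall>q\<in>points. p \<noteq> q \<longrightarrow>
        (SIGMA i:lines_through p. lines_through p - {i}) \<inter> (SIGMA i:lines_through q. lines_through q - {i}) = {}"
    proof (intro ballI impI equals0I)
      fix p q x assume p: "p \<in> points" and q: "q \<in> points" and "p \<noteq> q"
        and x: "x \<in> (SIGMA i:lines_through p. lines_through p - {i}) \<inter> (SIGMA i:lines_through q. lines_through q - {i})"
      have "p = H (fst x) \<inter> H (snd x)" using x by (intro point_eq_meet[OF p]) auto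
      moreover have "q = H (fst x) \<inter> H (snd x)" using x by (intro point_eq_meet[OF q]) auto
      ultimately show False using \<open>p \<noteq> q\<close> by simp
    qed
  qed (auto simp: finite_points finite_lines_through)
  finally show ?thesis using pairs finite_lines_through by simp
qed

text \<open>
  The left-hand side counts pairs of a line \<open>n\<close> and a point of it that also lies on an earlier line.
  For a given point, every line through it occurs except the one with the least index.
\<close>

lemma sum_points_on_lines:
  "(\<Sum>n<d. card ((\<lambda>i. H n \<inter> H i) ` {..<n})) = (\<Sum>p\<in>points. card (lines_through p) - 1)"
proof -
  have "(\<lambda>i. H n \<inter> H i) ` {..<n} = {p \<in> points. n \<in> lines_through p \<and> (\<exists>i<n. i \<in> lines_through p)}"
    if "n < d" for n
  proof (intro equalityI subsetI)
    fix p assume "p \<in> (\<lambda>i. H n \<inter> H i) ` {..<n}"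
    then obtain i where "i < n" "p = H n \<inter> H i" by blast
    then show "p \<in> {p \<in> points. n \<in> lines_through p \<and> (\<exists>i<n. i \<in> lines_through p)}"
      using that unfolding points_def lines_through_def by fastforce
  next
    fix p assume p: "p \<in> {p \<in> points. n \<in> lines_through p \<and> (\<exists>i<n. i \<in> lines_through p)}"
    then obtain i where "i < n" "i \<in> lines_through p" by blast
    then show "p \<in> (\<lambda>i. H n \<inter> H i) ` {..<n}"
      using point_eq_meet[of p n i] p by auto
  qed
  then have "(\<Sum>n<d. card ((\<lambda>i. H n \<inter> H i) ` {..<n})) =
      (\<Sum>n<d. card {p \<in> points. n \<in> lines_through p \<and> (\<exists>i<n. i \<in> lines_through p)})"
    by (intro sum.cong) auto
  also have "\<dots> = (\<Sum>p\<in>points. card {n \<in> {..<d}. n \<in> lines_through p \<and> (\<exists>i<n. i \<in> lines_through p)})"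
    by (rule sum_multicount_gen) (auto simp: finite_points)
  also have "\<dots> = (\<Sum>p\<in>points. card (lines_through p) - 1)"
  proof (rule sum.cong[OF refl])
    fix p assume "p \<in> points"
    then have ne: "lines_through p \<noteq> {}" by (rule lines_through_nonempty)
    let ?m = "Min (lines_through p)"
    have m: "?m \<in> lines_through p" by (rule Min_in[OF finite_lines_through ne])
    have "{n \<in> {..<d}. n \<in> lines_through p \<and> (\<exists>i<n. i \<in> lines_through p)} = lines_through p - {?m}"
    proof (intro equalityI subsetI)
      fix n assume "n \<in> {n \<in> {..<d}. n \<in> lines_through p \<and> (\<exists>i<n. i \<in> lines_through p)}"
      then obtain i where "n \<in> lines_through p" "i < n" "i \<in> lines_through p" by blast
      then show "n \<in> lines_through p - {?m}"
        using Min_le[OF finite_lines_through, of i p] by auto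
    next
      fix n assume n: "n \<in> lines_through p - {?m}"
      then have "?m < n" using Min_le[OF finite_lines_through, of n p] by auto
      then show "n \<in> {n \<in> {..<d}. n \<in> lines_through p \<and> (\<exists>i<n. i \<in> lines_through p)}"
        using n m by (auto simp: lines_through_def)
    qed
    then show "card {n \<in> {..<d}. n \<in> lines_through p \<and> (\<exists>i<n. i \<in> lines_through p)} = card (lines_through p) - 1"
      using m by (simp add: card_Diff_singleton)
  qed
  finally show ?thesis .
qed

text \<open>
  For the zero sets of an arrangement this is its intersection lattice.
\<close>

definition flats :: "'a set set" where
  "flats = Inter ` Pow (H ` {..<d})"

lemma line_in_flats: "i < d \<Longrightarrow> H i \<in> flats"
  unfolding flats_def by (intro image_eqI[of _ _ "{H i}"]) auto

lemma point_in_flats: "i < d \<Longrightarrow> j < d \<Longrightarrow> H i \<inter> H j \<in> flats"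
  unfolding flats_def by (intro image_eqI[of _ _ "{H i, H j}"]) auto

text \<open>
  A flat is an intersection of lines, so if it fails to contain \<open>U\<close>, then so does one of these lines.
  All statements about covering relations follow from this.
\<close>

lemma flat_below_line:
  assumes "W \<in> flats" "\<not> U \<subseteq> W"
  obtains j where "j < d" "W \<subseteq> H j" "\<not> U \<subseteq> H j"
proof -
  obtain \<F> where F: "\<F> \<subseteq> H ` {..<d}" "W = \<Inter>\<F>" using assms(1) unfolding flats_def by auto
  then obtain h where "h \<in> \<F>" "\<not> U \<subseteq> h" using assms(2) by blast
  then show ?thesis using F that by blast
qed

lemma least_flats: "least_elems flats = {UNIV}"
proof -
  have "UNIV \<in> flats" unfolding flats_def by (intro image_eqI[of _ _ "{}"]) auto
  then show ?thesis unfolding least_elems_def by blast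
qed

lemma atoms_flats: "atoms flats = H ` {..<d}"
proof -
  have "covered_by flats UNIV V \<longleftrightarrow> V \<in> H ` {..<d}" for V
  proof
    assume V: "covered_by flats UNIV V"
    then have "V \<in> flats" "\<not> UNIV \<subseteq> V" by (auto simp: covered_by_def)
    then obtain j where j: "j < d" "V \<subseteq> H j" by (rule flat_below_line)
    then have "V = H j" using V line_in_flats[OF j(1)] proper[OF j(1)] unfolding covered_by_def by blast
    then show "V \<in> H ` {..<d}" using j(1) by blast
  next
    assume "V \<in> H ` {..<d}"
    then obtain i where i: "i < d" "V = H i" by blast
    have "False" if W: "W \<in> flats" "W \<subset> UNIV" "H i \<subset> W" for W
    proof -
      have "\<not> UNIV \<subseteq> W" using W by blast
      with W(1) obtain j where "j < d" "W \<subseteq> H j" by (rule flat_below_line)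
      then show False using incomparable[OF i(1), of j] W(3) by blast
    qed
    moreover have "UNIV \<in> flats" using least_flats unfolding least_elems_def by blast
    ultimately show "covered_by flats UNIV V"
      using line_in_flats[OF i(1)] proper[OF i(1)] i(2) unfolding covered_by_def by blast
  qed
  then show ?thesis unfolding atoms_def least_flats by simp
qed

lemma multiple_points_flats: "multiple_points flats = points"
proof -
  have "covered_by flats (H i) V \<longleftrightarrow> (\<exists>j<d. j \<noteq> i \<and> V = H i \<inter> H j)" if i: "i < d" for i V
  proof
    assume V: "covered_by flats (H i) V"
    then have "V \<in> flats" "\<not> H i \<subseteq> V" by (auto simp: covered_by_def)
    then obtain j where j: "j < d" "V \<subseteq> H j" "\<not> H i \<subseteq> H j" by (rule flat_below_line)
    then have "V = H i \<inter> H j"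
      using V point_in_flats[OF i j(1)] unfolding covered_by_def by blast
    then show "\<exists>j<d. j \<noteq> i \<and> V = H i \<inter> H j" using j by blast
  next
    assume "\<exists>j<d. j \<noteq> i \<and> V = H i \<inter> H j"
    then obtain j where j: "j < d" "j \<noteq> i" "V = H i \<inter> H j" by blast
    have "False" if W: "W \<in> flats" "W \<subset> H i" "V \<subset> W" for W
    proof -
      have "\<not> H i \<subseteq> W" using W by blast
      with W(1) obtain l where l: "l < d" "W \<subseteq> H l" "\<not> H i \<subseteq> H l" by (rule flat_below_line)
      then have "H i \<inter> H j = H i \<inter> H l"
        using meet[of i j i l] i j W(3) by blast
      then show False using W l j(3) by blast
    qed
    moreover have "V \<subset> H i" using incomparable[OF i j(1)] j by blast
    ultimately show "covered_by flats (H i) V"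
      using point_in_flats[OF i j(1)] line_in_flats[OF i] j(3) unfolding covered_by_def by blast
  qed
  then have "multiple_points flats = {p. \<exists>i<d. \<exists>j<d. j \<noteq> i \<and> p = H i \<inter> H j}"
    unfolding multiple_points_def atoms_flats by auto
  then show ?thesis unfolding points_def by blast
qed

lemma multiplicity_flats: "multiplicity_at flats p = card (lines_through p)"
proof -
  have "{h \<in> H ` {..<d}. p \<subseteq> h} = H ` lines_through p" by (auto simp: lines_through_def)
  moreover have "inj_on H (lines_through p)"
    using incomparable by (intro inj_onI) (simp add: lines_through_def)
  ultimately show ?thesis unfolding multiplicity_at_def atoms_flats by (simp add: card_image)
qed

lemma lattice_sum_flats: "lattice_sum g flats = (\<Sum>p\<in>points. g (card (lines_through p)))"
  by (simp add: lattice_sum_def multiple_points_flats multiplicity_flats)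

lemma lines_through_ge_1: "p \<in> points \<Longrightarrow> 1 \<le> card (lines_through p)"
  using lines_through_nonempty finite_lines_through by (simp add: Suc_le_eq card_gt_0_iff)

lemma lattice_sum_linear_flats:
  "lattice_sum (\<lambda>m. real m - 1) flats = real (\<Sum>n<d. card ((\<lambda>i. H n \<inter> H i) ` {..<n}))"
  unfolding lattice_sum_flats sum_points_on_lines of_nat_sum
  by (rule sum.cong) (use lines_through_ge_1 in \<open>simp_all add: of_nat_diff\<close>)

lemma lattice_sum_square_flats:
  "lattice_sum (\<lambda>m. (real m - 1)\<^sup>2) flats + lattice_sum (\<lambda>m. real m - 1) flats = real d * (real d - 1)"
proof -
  have "real d * (real d - 1) = real (d * (d - 1))" by (cases d) (simp_all add: algebra_simps)
  also have "\<dots> = (\<Sum>p\<in>points. real (card (lines_through p) * (card (lines_through p) - 1)))"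
    by (simp only: of_nat_sum[symmetric] sum_pairs)
  also have "\<dots> = (\<Sum>p\<in>points. (real (card (lines_through p)) - 1)\<^sup>2 + (real (card (lines_through p)) - 1))"
    by (rule sum.cong) (use lines_through_ge_1 in \<open>simp_all add: of_nat_diff power2_eq_square algebra_simps\<close>)
  finally show ?thesis by (simp add: lattice_sum_flats sum.distrib)
qed

end

context line_arrangement begin

text \<open>
  If the point of the lines \<open>a, b\<close> lies on \<open>c\<close>, it is also the point of \<open>a, c\<close>. Exchanging the lines one
  after the other in this way leads from \<open>i, j\<close> to \<open>l, m\<close>.
\<close>

lemma incidence_zeros: "incidence d (\<lambda>i. zeros (coef (\<alpha> i)))"
proof
  let ?H = "\<lambda>i. zeros (coef (\<alpha> i))"
  fix i j l m assume ij: "i < d" "j < d" "i \<noteq> j" and lm: "l < d" "m < d" "l \<noteq> m"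
    and sub: "?H i \<inter> ?H j \<subseteq> ?H l" "?H i \<inter> ?H j \<subseteq> ?H m"
  have pivot: "?H a \<inter> ?H b = ?H a \<inter> ?H c"
    if "a < d" "b < d" "c < d" "a \<noteq> b" "a \<noteq> c" "?H a \<inter> ?H b \<subseteq> ?H c" for a b c
    using zeros_Int_eq_iff[OF distinct[OF that(1,2,4)] distinct[OF that(1,3,5)]]
      zeros_Int_subset_iff[OF distinct[OF that(1,2,4)]] that(6) by blast
  show "?H i \<inter> ?H j = ?H l \<inter> ?H m"
  proof (cases "l = i")
    case True
    then show ?thesis using pivot[of i j m] ij lm sub by blast
  next
    case False
    then have "?H i \<inter> ?H j = ?H l \<inter> ?H i" using pivot[of i j l] ij lm sub by blast
    then show ?thesis using pivot[of l i m] False ij lm sub by blast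
  qed
next
  let ?H = "\<lambda>i. zeros (coef (\<alpha> i))"
  have separate: "\<exists>v. v \<in> ?H i \<and> v \<notin> ?H j" if "i < d" "j < d" "i \<noteq> j" for i j
  proof -
    have "cross (coef (\<alpha> i)) (coef (\<alpha> j)) \<noteq> 0" by (rule distinct[OF that])
    then obtain v where "dot (coef (\<alpha> i)) v = 0" "dot (coef (\<alpha> j)) v = 1"
      by (rule exists_dual_vector)
    then show ?thesis by (intro exI[of _ v]) (simp add: zeros_def)
  qed
  {
    fix i j assume "i < d" "j < d" "?H i \<subseteq> ?H j"
    then show "i = j" using separate[of i j] by blast
  }
  fix i assume i: "i < d"
  obtain j where "j < d" "j \<noteq> i" using two_lines that[of 0] that[of 1] by (cases "i = 0") auto
  then show "?H i \<noteq> UNIV" using separate[of j i] i by blast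
qed

sublocale incidence d "\<lambda>i. zeros (coef (\<alpha> i))"
  by (rule incidence_zeros)

lemma lattice_sum_linear_eq: "lattice_sum (\<lambda>m. real m - 1) flats = real (\<Sum>n<d. card (points_on n))"
  unfolding lattice_sum_linear_flats points_on_def ..

text \<open>
  By \<open>free_exponents\<close> the sum is at least \<open>(d\<^sub>1 + d\<^sub>2)\<^sup>2 - d\<^sub>1 d\<^sub>2\<close>, and \<open>4 d\<^sub>1 d\<^sub>2 \<le> (d\<^sub>1 + d\<^sub>2)\<^sup>2\<close>.
\<close>

theorem free_imp_total_Tjurina_ge:
  assumes "free_curve equation"
  shows "3 / 4 * (real d - 1)\<^sup>2 \<le> lattice_sum (\<lambda>m. (real m - 1)\<^sup>2) flats"
proof -
  obtain d1 d2 \<phi> where "AR_graded_iso d1 d2 equation \<phi>"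
    using assms unfolding free_curve_def by blast
  note e = free_exponents[OF this]
  have d: "real d = real d1 + real d2 + 1" using arg_cong[OF e(1), of real] by simp
  have "lattice_sum (\<lambda>m. real m - 1) flats \<le> real d1 * real d2 + real d1 + real d2"
    using of_nat_mono[where ?'a = real, OF e(2)] unfolding lattice_sum_linear_eq by (simp only: of_nat_add of_nat_mult)
  moreover have "0 \<le> (real d1 - real d2)\<^sup>2" by simp
  ultimately show ?thesis
    using lattice_sum_square_flats unfolding d by (simp add: power2_eq_square algebra_simps)
qed

end

lemma eval3_linear_form:
  assumes "l \<in> S_deg 1"
  shows "eval3 l v = dot (coef l) v"
proof -
  let ?e = "\<lambda>i::3. Poly_Mapping.single i (1::nat)"
  have inj: "inj ?e"
    by (rule injI) (metis lookup_single_eq lookup_single_not_eq zero_neq_one)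
  have "Poly_Mapping.keys l \<subseteq> range ?e"
  proof
    fix m assume "m \<in> Poly_Mapping.keys l"
    then have "sum (Poly_Mapping.lookup m) UNIV = 1" using assms by (auto simp: S_deg_def mdeg_def)
    then obtain i where "Poly_Mapping.lookup m i = 1" "\<forall>j. j \<noteq> i \<longrightarrow> Poly_Mapping.lookup m j = 0"
      using sum_eq_1_iff[of UNIV "Poly_Mapping.lookup m"] by auto
    then have "m = ?e i" by (intro poly_mapping_eqI) (auto simp: lookup_single when_def)
    then show "m \<in> range ?e" by blast
  qed
  then have "eval3 l v = (\<Sum>m\<in>range ?e. Poly_Mapping.lookup l m * (\<Prod>i\<in>UNIV. (v $ i) ^ Poly_Mapping.lookup m i))"
    unfolding eval3_def by (intro sum.mono_neutral_left) (auto simp: in_keys_iff)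
  also have "\<dots> = (\<Sum>i\<in>UNIV. coef l $ i * (\<Prod>j\<in>UNIV. (v $ j) ^ Poly_Mapping.lookup (?e i) j))"
    unfolding sum.reindex[OF inj] by (simp add: coef_def)
  also have "\<dots> = dot (coef l) v"
    unfolding dot_def
  proof (rule sum.cong[OF refl])
    fix i
    have "(\<Prod>j\<in>UNIV. (v $ j) ^ Poly_Mapping.lookup (?e i) j) = (\<Prod>j\<in>UNIV. if j = i then v $ j else 1)"
      by (intro prod.cong) (auto simp: lookup_single when_def)
    then show "coef l $ i * (\<Prod>j\<in>UNIV. (v $ j) ^ Poly_Mapping.lookup (?e i) j) = coef l $ i * v $ i" by simp
  qed
  finally show ?thesis .
qed

lemma line_proj_class:
  assumes "l \<in> S_deg 1"
  shows "line (proj_class l) = zeros (coef l)"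
proof -
  have "eval3 (const c * l) v = c * dot (coef l) v" for c v
    using eval3_linear_form[OF const_mult_in_S_deg[OF assms]]
    by (simp add: coef_const_mult dot_def sum_distrib_left mult.assoc)
  then have "v \<in> line (proj_class l) \<longleftrightarrow> (\<forall>c. c \<noteq> 0 \<longrightarrow> c * dot (coef l) v = 0)" for v
    by (auto simp: line_def proj_class_def)
  then show ?thesis by (auto simp: zeros_def intro: exI[of _ 1])
qed

lemma proj_class_const_mult:
  assumes "c \<noteq> 0"
  shows "proj_class (const c * l) = proj_class l"
proof (intro equalityI subsetI)
  fix p assume "p \<in> proj_class (const c * l)"
  then obtain b where "b \<noteq> 0" "p = const (b * c) * l" by (auto simp: proj_class_def const_mult mult.assoc)
  then show "p \<in> proj_class l"
    using assms unfolding proj_class_def by (intro CollectI exI[of _ "b * c"]) simp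
next
  fix p assume "p \<in> proj_class l"
  then obtain b where "b \<noteq> 0" "p = const b * l" by (auto simp: proj_class_def)
  then have "p = const (b / c) * (const c * l)" "b / c \<noteq> 0"
    using assms by (simp_all add: mult.assoc[symmetric] flip: const_mult)
  then show "p \<in> proj_class (const c * l)" unfolding proj_class_def by blast
qed

text \<open>
  If all \<open>2 \<times> 2\<close> minors of the two coefficient vectors vanish, the forms are proportional.
\<close>

lemma cross_nonzero_if_proj_class_neq:
  assumes "a \<in> S_deg 1" "b \<in> S_deg 1" "a \<noteq> 0" "b \<noteq> 0" "proj_class a \<noteq> proj_class b"
  shows "cross (coef a) (coef b) \<noteq> 0"
proof
  assume "cross (coef a) (coef b) = 0"
  then have "coef a $ 2 * coef b $ 3 = coef a $ 3 * coef b $ 2" "coef a $ 3 * coef b $ 1 = coef a $ 1 * coef b $ 3"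
    "coef a $ 1 * coef b $ 2 = coef a $ 2 * coef b $ 1"
    by (simp_all add: cross_def vec_eq_iff forall_3)
  then have minors: "coef a $ i * coef b $ j = coef a $ j * coef b $ i" for i j
    using exhaust_3[of i] exhaust_3[of j] by auto
  have "coef a \<noteq> 0" using assms(1,3) coef_inject[of a 0] by (auto simp: coef_def vec_eq_iff)
  then obtain i where i: "coef a $ i \<noteq> 0" by (auto simp: vec_eq_iff)
  define t where "t = coef b $ i / coef a $ i"
  have "coef b $ j = t * coef a $ j" for j
    using minors[of i j] i by (simp add: t_def field_simps)
  then have "coef b = coef (const t * a)" by (simp add: coef_const_mult vec_eq_iff)
  then have b: "b = const t * a"
    using coef_inject[OF assms(2) const_mult_in_S_deg[OF assms(1)]] by simp
  then have "t \<noteq> 0" using assms(4) by auto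
  then show False using proj_class_const_mult[of t a] b assms(5) by simp
qed

lemma arrangement_of_representatives:
  assumes A: "A \<in> X d" and d: "2 \<le> d" and ls: "list_all2 (\<in>) ls A"
  shows "line_arrangement d (\<lambda>i. ls ! i)"
    and "prod_list ls = line_arrangement.equation d (\<lambda>i. ls ! i)"
    and "intersection_lattice A = incidence.flats d (\<lambda>i. zeros (coef (ls ! i)))"
proof -
  have len: "length A = d" "length ls = d" using A ls by (auto simp: X_def dest: list_all2_lengthD)
  have rep: "ls ! i \<in> S_deg 1 \<and> ls ! i \<noteq> 0 \<and> A ! i = proj_class (ls ! i)" if "i < d" for i
  proof -
    have "A ! i \<in> PS1" using A that len by (auto simp: X_def)
    then obtain l where l: "l \<in> S_deg 1" "l \<noteq> 0" "A ! i = proj_class l" by (auto simp: PS1_def)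
    have "ls ! i \<in> A ! i" using ls that len by (simp add: list_all2_conv_all_nth)
    then obtain c where c: "c \<noteq> 0" "ls ! i = const c * l" using l(3) by (auto simp: proj_class_def)
    then show ?thesis using l const_mult_in_S_deg proj_class_const_mult by simp
  qed
  have dist: "A ! i \<noteq> A ! j" if "i < d" "j < d" "i \<noteq> j" for i j
    using A that by (auto simp: X_def nth_eq_iff_index_eq)
  show arr: "line_arrangement d (\<lambda>i. ls ! i)"
  proof
    fix i j assume "i < d" "j < d" "i \<noteq> j"
    then show "cross (coef (ls ! i)) (coef (ls ! j)) \<noteq> 0"
      using rep dist by (intro cross_nonzero_if_proj_class_neq) metis+
  qed (use d rep in auto)
  interpret line_arrangement d "\<lambda>i. ls ! i" by (rule arr)
  show "prod_list ls = equation"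
    using len prod.distinct_set_conv_list[of "[0..<d]" "(!) ls"] map_nth[of ls]
    by (simp add: equation_def atLeast0LessThan)
  have "line ` set A = (\<lambda>i. zeros (coef (ls ! i))) ` {..<d}"
  proof -
    have "set A = (!) A ` {..<d}" using len by (auto simp: set_conv_nth)
    then have "line ` set A = (\<lambda>i. line (A ! i)) ` {..<d}" by (simp add: image_image)
    also have "\<dots> = (\<lambda>i. zeros (coef (ls ! i))) ` {..<d}"
      by (rule image_cong) (use rep line_proj_class in auto)
    finally show ?thesis .
  qed
  then show "intersection_lattice A = flats" by (simp add: intersection_lattice_def flats_def)
qed

text \<open>
  Both claims are evaluated on an arrangement that represents \<open>L\<close>: for the first one it is the
  supposedly free one, for the second one any arrangement with any choice of linear forms.
\<close>

theorem proposition6p5: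
  fixes d :: nat and L :: "(complex ^ 3) set set set"
  assumes "d \<ge> 4" and "L \<in> lattice_classes d"
  shows "(tau L < 3 / 4 * (real d - 1)\<^sup>2 \<longrightarrow> FX d \<inter> X_lat d L = {}) \<and>
         (point_sum (\<lambda>m. real m - 1) L > (real d + 3) * (real d - 1) / 4 \<longrightarrow>
            tau L < 3 / 4 * (real d - 1)\<^sup>2)"
proof (intro conjI impI)
  have d: "2 \<le> d" using assms(1) by simp
  assume tau: "tau L < 3 / 4 * (real d - 1)\<^sup>2"
  show "FX d \<inter> X_lat d L = {}"
  proof (rule ccontr)
    assume "FX d \<inter> X_lat d L \<noteq> {}"
    then obtain A ls where A: "A \<in> X d" "intersection_lattice A \<in> L"
      and ls: "list_all2 (\<in>) ls A" "free_curve (prod_list ls)"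
      by (auto simp: FX_def X_lat_def)
    interpret line_arrangement d "\<lambda>i. ls ! i"
      by (rule arrangement_of_representatives(1)[OF A(1) d ls(1)])
    have "3 / 4 * (real d - 1)\<^sup>2 \<le> lattice_sum (\<lambda>m. (real m - 1)\<^sup>2) flats"
      using ls(2) unfolding arrangement_of_representatives(2)[OF A(1) d ls(1)]
      by (rule free_imp_total_Tjurina_ge)
    also have "\<dots> = tau L"
      unfolding tau_def point_sum_eq[OF assms(2) A(2)] arrangement_of_representatives(3)[OF A(1) d ls(1)] ..
    finally show False using tau by simp
  qed
next
  have d: "2 \<le> d" using assms(1) by simp
  assume b: "point_sum (\<lambda>m. real m - 1) L > (real d + 3) * (real d - 1) / 4"
  have "L \<noteq> {}" "L \<subseteq> intersection_lattice ` X d"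
    using assms(2) in_quotient_imp_non_empty[OF equiv_lattice_iso_rel] in_quotient_imp_subset[OF equiv_lattice_iso_rel]
    unfolding lattice_classes_def by blast+
  then obtain A where A: "A \<in> X d" "intersection_lattice A \<in> L" by blast
  let ?ls = "map (\<lambda>K. SOME l. l \<in> K) A"
  have "(SOME l. l \<in> K) \<in> K" if "K \<in> set A" for K
  proof -
    have "K \<in> PS1" using that A(1) by (auto simp: X_def)
    then obtain l where "K = proj_class l" by (auto simp: PS1_def)
    moreover have "const 1 * l \<in> proj_class l" unfolding proj_class_def by (intro CollectI exI[of _ 1]) simp
    ultimately have "const 1 * l \<in> K" by simp
    then show ?thesis by (rule someI)
  qed
  then have ls: "list_all2 (\<in>) ?ls A" by (auto simp: list_all2_conv_all_nth)
  interpret line_arrangement d "\<lambda>i. ?ls ! i"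
    by (rule arrangement_of_representatives(1)[OF A(1) d ls])
  have sum: "point_sum g L = lattice_sum g flats" for g
    unfolding point_sum_eq[OF assms(2) A(2)] arrangement_of_representatives(3)[OF A(1) d ls] ..
  have "tau L = real d * (real d - 1) - point_sum (\<lambda>m. real m - 1) L"
    using lattice_sum_square_flats unfolding tau_def sum by simp
  also have "\<dots> < real d * (real d - 1) - (real d + 3) * (real d - 1) / 4" using b by simp
  also have "\<dots> = 3 / 4 * (real d - 1)\<^sup>2" by (simp add: power2_eq_square field_simps)
  finally show "tau L < 3 / 4 * (real d - 1)\<^sup>2" .
qed

end
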